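(* Let $\tau\in\mathbb{H}$ and $\lambda\in\mathbb{C}-\{0,1\}$ be such that $j(\tau)=256\frac{(\lambda^2-\lambda+1)^3}{(\lambda^2-\lambda)^2}$. Suppose that $\lambda'\in\mathbb{C}-\{0,1\}$ satisfies $$\left(\lambda+\lambda'+6\sqrt{\lambda\lambda'}\right)^2=16\left(1+\sqrt{\lambda\lambda'}\right)^2\sqrt{\lambda\lambda'}$$ for some choice of the square root $\sqrt{\lambda\lambda'}\in\mathbb{C}$ (the same choice at every occurrence). Then $256\frac{(\lambda'^2-\lambda'+1)^3}{(\lambda'^2-\lambda')^2}$ belongs to the set $$\left\{j(3\tau),\,j\left(\frac{\tau}{3}\right),\,j\left(\frac{\tau+2}{-\tau+1}\right),\,j\left(\frac{\tau-2}{\tau+1}\right)\right\}.$$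
   Context: $\mathbb{H}$ is the upper half plane. $j:\mathbb{H}\to\mathbb{C}$ is the usual modular $j$-function for $\mathrm{SL}_2(\mathbb{Z})$, normalized so that $j(\tau)=\frac1q+744+196884q+\cdots$ with $q=e^{2\pi\mathrm{i}\tau}$ (so $j(\mathrm{i})=1728$). *)

theory Defs
  imports "HOL-Complex_Analysis.Complex_Analysis"
begin

definition upper_half_plane :: "complex set" where
  "upper_half_plane = {\<tau>. Im \<tau> > 0}"

text \<open>
  The Eisenstein series of the lattice spanned by \<open>\<tau>\<close> and \<open>1\<close>. The (unordered) sum converges
  for \<open>\<tau>\<close> in the upper half plane and \<open>k \<ge> 3\<close>; only \<open>k = 4\<close> and \<open>k = 6\<close> are used.
\<close>

definition eisenstein_G :: "nat \<Rightarrow> complex \<Rightarrow> complex" where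
  "eisenstein_G k \<tau> =
     (\<Sum>\<^sub>\<infinity>(m, n) \<in> UNIV - {(0, 0)}. 1 / (of_int m * \<tau> + of_int n) ^ k)"

definition weierstrass_g2 :: "complex \<Rightarrow> complex" where
  "weierstrass_g2 \<tau> = 60 * eisenstein_G 4 \<tau>"

definition weierstrass_g3 :: "complex \<Rightarrow> complex" where
  "weierstrass_g3 \<tau> = 140 * eisenstein_G 6 \<tau>"

text \<open>
  The factor 1728 gives the normalization \<open>1/q + 744 + 196884 q + \<dots>\<close> with
  \<open>q = exp (2 \<pi> \<i> \<tau>)\<close>, so that the value at \<open>\<i>\<close> is 1728. The denominator is
  the modular discriminant, which has no zero in the upper half plane. Values outside the
  upper half plane are meaningless.
\<close>

definition modular_j :: "complex \<Rightarrow> complex" where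
  "modular_j \<tau> =
     1728 * weierstrass_g2 \<tau> ^ 3 / (weierstrass_g2 \<tau> ^ 3 - 27 * weierstrass_g3 \<tau> ^ 2)"

end

theory Submission
  imports Defs
begin

text \<open>
  Let \<open>L\<close> be the lattice of \<open>\<tau>\<close>, with Weierstrass function \<open>\<wp>\<close> and invariants \<open>g\<^sub>2\<close>, \<open>g\<^sub>3\<close>. For a point
  \<open>u\<close> of order 3 modulo \<open>L\<close>, summing over the three cosets of \<open>L\<close> in \<open>L + \<int> u\<close> expresses the
  invariants of \<open>L + \<int> u\<close> by \<open>x = \<wp> u\<close>, namely \<open>120 x\<^sup>2 - 9 g\<^sub>2\<close> and
  \<open>280 x\<^sup>3 - 42 g\<^sub>2 x - 27 g\<^sub>3\<close>. The four lattices containing \<open>L\<close> with index 3 yield the four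
  values of \<open>j\<close> in the theorem, and the four values \<open>\<wp> u\<close> are distinct roots of the 3-division
  quartic, hence all of its roots; this also forces the discriminant not to vanish. The hypothesis
  on \<open>j \<tau>\<close> then rescales \<open>g\<^sub>2\<close>, \<open>g\<^sub>3\<close> to the invariants of the Legendre curve of \<open>l\<close>. The modular
  equation is the rational curve \<open>l = p (2 + p)\<^sup>3 / (1 + 2 p)\<^sup>3\<close>, \<open>l' = p\<^sup>3 (2 + p) / (1 + 2 p)\<close>,
  along which the Legendre curve of \<open>l\<close> has a 3-torsion point with abscissa rational in \<open>p\<close>, and its
  quotient is the Legendre curve of \<open>l'\<close>.
\<close>

section \<open>Legendre curves and the modular equation\<close>

text \<open>Invariants of \<open>y^2 = 4 X (X - 1) (X - l)\<close> in the form
  \<open>y^2 = 4 x^3 - g2 x - g3\<close>, after the shift \<open>X = x + (l + 1) / 3\<close> that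
  removes the quadratic term.\<close>

definition legendre_g2 :: "complex \<Rightarrow> complex" where
  "legendre_g2 l = 4 / 3 * (l^2 - l + 1)"

definition legendre_g3 :: "complex \<Rightarrow> complex" where
  "legendre_g3 l = 4 / 27 * ((l + 1) * (l - 2) * (2 * l - 1))"

definition j_of :: "complex \<Rightarrow> complex \<Rightarrow> complex" where
  "j_of a b = 1728 * a ^ 3 / (a ^ 3 - 27 * b ^ 2)"

text \<open>Sixteen times the 3-division polynomial of \<open>y^2 = 4 x^3 - a x - b\<close>: for a
  nonsingular curve its roots are the abscissas of the points of order 3.\<close>

definition psi3 :: "complex \<Rightarrow> complex \<Rightarrow> complex \<Rightarrow> complex" where
  "psi3 a b x = 48 * x ^ 4 - 24 * a * x ^ 2 - 48 * b * x - a ^ 2"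

lemma legendre_discriminant:
  "legendre_g2 l ^ 3 - 27 * legendre_g3 l ^ 2 = 16 * (l^2 - l) ^ 2"
  unfolding legendre_g2_def legendre_g3_def by (simp add: field_simps) algebra

lemma j_of_legendre:
  assumes "l \<noteq> 0" "l \<noteq> 1"
  shows "j_of (legendre_g2 l) (legendre_g3 l) = 256 * ((l^2 - l + 1)^3 / (l^2 - l)^2)"
proof -
  have "l^2 - l \<noteq> 0" using assms by (auto simp: power2_eq_square)
  thus ?thesis
    unfolding j_of_def legendre_discriminant unfolding legendre_g2_def power_mult_distrib by (simp add: power_divide)
qed

lemma j_of_scale:
  assumes "c \<noteq> 0"
  shows "j_of (c ^ 2 * a) (c ^ 3 * b) = j_of a b"
proof -
  have "(c ^ 2 * a) ^ 3 - 27 * (c ^ 3 * b) ^ 2 = c ^ 6 * (a ^ 3 - 27 * b ^ 2)"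
       "(c ^ 2 * a) ^ 3 = c ^ 6 * a ^ 3"
    by (simp_all add: power_mult_distrib algebra_simps)
  thus ?thesis using assms by (simp add: j_of_def)
qed

text \<open>Cross-multiplication leaves \<open>a^3 b'^2 = a'^3 b^2\<close>. If nothing vanishes,
  \<open>c\<close> must be the quotient of \<open>c^3 = b / b'\<close> by
  \<open>c^2 = a / a'\<close>, so no root is extracted. For j equal to 0 or 1728 one of the two
  equations is trivial, and a cube or square root solves the other.\<close>

lemma j_of_eq_imp_scale:
  assumes "j_of a b = j_of a' b'" "a ^ 3 - 27 * b ^ 2 \<noteq> 0" "a' ^ 3 - 27 * b' ^ 2 \<noteq> 0"
  obtains c where "c \<noteq> 0" "a = c ^ 2 * a'" "b = c ^ 3 * b'"
proof -
  have cross: "a ^ 3 * b' ^ 2 = a' ^ 3 * b ^ 2"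
    using assms by (simp add: j_of_def field_simps)
  show ?thesis
  proof (cases "a' = 0 \<or> b' = 0")
    case False
    hence nz: "a' \<noteq> 0" "b' \<noteq> 0" by auto
    have "a \<noteq> 0" using cross nz assms(2) by auto
    hence "b \<noteq> 0" using cross nz by auto
    define c where "c = b * a' / (b' * a)"
    show ?thesis
    proof
      show "c \<noteq> 0" using nz \<open>a \<noteq> 0\<close> \<open>b \<noteq> 0\<close> by (simp add: c_def)
      show "a = c ^ 2 * a'" unfolding c_def using nz \<open>a \<noteq> 0\<close> cross
        by (simp add: field_simps) algebra
      show "b = c ^ 3 * b'" unfolding c_def using nz \<open>a \<noteq> 0\<close> \<open>b \<noteq> 0\<close> cross
        by (simp add: field_simps) algebra
    qed
  next
    case True
    thus ?thesis
    proof
      assume "a' = 0"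
      hence "b' \<noteq> 0" using assms(3) by auto
      hence "a = 0" using cross \<open>a' = 0\<close> by auto
      obtain c where c: "c ^ 3 = b / b'" by (metis exists_complex_root zero_neq_numeral)
      show ?thesis
        by (rule that[of c]) (use c \<open>a = 0\<close> \<open>a' = 0\<close> \<open>b' \<noteq> 0\<close> assms(2) in \<open>auto simp: field_simps\<close>)
    next
      assume "b' = 0"
      hence "a' \<noteq> 0" using assms(3) by auto
      hence "b = 0" using cross \<open>b' = 0\<close> by auto
      obtain c where c: "c ^ 2 = a / a'" by (metis exists_complex_root zero_neq_numeral)
      show ?thesis
        by (rule that[of c]) (use c \<open>b = 0\<close> \<open>b' = 0\<close> \<open>a' \<noteq> 0\<close> assms(2) in \<open>auto simp: field_simps\<close>)
    qed
  qed
qed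

lemma modular_equation_parametrization:
  fixes l l' s :: complex
  assumes "l \<noteq> 0" "l \<noteq> 1" "l' \<noteq> 0" "l' \<noteq> 1"
    and "s ^ 2 = l * l'" "(l + l' + 6 * s)^2 = 16 * (1 + s)^2 * s"
  obtains p where "1 + 2 * p \<noteq> 0" "l = p * (2 + p) ^ 3 / (1 + 2 * p) ^ 3"
    "l' = p ^ 3 * (2 + p) / (1 + 2 * p)"
proof -
  \<comment> \<open>With \<open>s = t0^2\<close> both sides of the modular equation are squares. The
    sign of the square root is absorbed into \<open>t\<close>, so that \<open>t\<close> determines
    both the sum and the product of \<open>l\<close> and \<open>l'\<close>.\<close>
  obtain t0 where t0: "t0 ^ 2 = s" by (metis exists_complex_root zero_neq_numeral)
  have "(l + l' + 6 * s)^2 = (4 * t0 * (1 + s))^2"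
    using assms(6) t0 by algebra
  hence "l + l' + 6 * s = 4 * t0 * (1 + s) \<or> l + l' + 6 * s = 4 * (-t0) * (1 + s)"
    by (auto simp: power2_eq_iff)
  then obtain t where t: "t ^ 2 = s" "l + l' + 6 * s = 4 * t * (1 + s)"
    using t0 by (metis power2_minus)
  have t4: "l * l' = t ^ 4" using assms(5) t(1) by algebra
  have sum: "l + l' = 4 * t - 6 * t ^ 2 + 4 * t ^ 3"
    using t(2) unfolding t(1)[symmetric] by algebra
  have "t \<noteq> 0" using t4 assms by auto
  have "t \<noteq> 1"
  proof
    assume "t = 1"
    hence "l * l' = 1" "l' = 2 - l" using t4 sum by (auto simp: algebra_simps)
    hence "(l - 1) ^ 2 = 0" by algebra
    thus False using assms by auto
  qed
  \<comment> \<open>A quarter of the discriminant of the quadratic with roots \<open>l\<close>,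
    \<open>l'\<close> is \<open>t^2 (t - 1)^2\<close> times \<open>4 (t^2 - t + 1)\<close>. Hence
    \<open>p = w + t - 1\<close> for a root \<open>w\<close> of \<open>w^2 = t^2 - t + 1\<close>,
    and \<open>p\<close> is a rational parameter of this conic: the equation becomes linear in
    \<open>t\<close>.\<close>
  define p where "p = (l' - t ^ 2) / (2 * t * (t - 1))"
  have d: "2 * t * (t - 1) \<noteq> 0" using \<open>t \<noteq> 0\<close> \<open>t \<noteq> 1\<close> by auto
  have p: "2 * t * (t - 1) * p = l' - t ^ 2" using d by (simp add: p_def)
  have quad: "l' ^ 2 - (4 * t - 6 * t ^ 2 + 4 * t ^ 3) * l' + t ^ 4 = 0"
    using t4 sum by algebra
  have "(2 * t * (t - 1)) ^ 2 * (p ^ 2 * t - l') = 0" using p quad by algebra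
  hence l': "l' = p ^ 2 * t" using d by auto
  have "t * (t * (1 + 2 * p) - p * (2 + p)) = 0" using p l' by algebra
  hence tp: "t * (1 + 2 * p) = p * (2 + p)" using \<open>t \<noteq> 0\<close> by auto
  have nz: "1 + 2 * p \<noteq> 0"
  proof
    assume *: "1 + 2 * p = 0"
    hence "p * (2 + p) = 0" using tp by auto
    with * have "3 = (0::complex)" by algebra
    thus False by simp
  qed
  have "p \<noteq> 0" using l' assms by auto
  have "t ^ 3 = l * p ^ 2" using t4 l' \<open>t \<noteq> 0\<close> by (simp add: eval_nat_numeral)
  hence "p ^ 2 * (l * (1 + 2 * p) ^ 3) = p ^ 2 * (p * (2 + p) ^ 3)" using tp by algebra
  hence "l * (1 + 2 * p) ^ 3 = p * (2 + p) ^ 3" using \<open>p \<noteq> 0\<close> by auto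
  moreover have "l' * (1 + 2 * p) = p ^ 3 * (2 + p)" using l' tp by algebra
  ultimately show ?thesis using nz by (intro that[of p]) (auto simp: field_simps)
qed

text \<open>The left sides of the last two claims are the invariants of the quotient by the subgroup
  of order 3 whose nonzero points have abscissa \<open>x\<close>. The factor \<open>c\<close>
  rescales the Legendre curve of \<open>l'\<close> to this quotient. In the unshifted coordinate the
  abscissa is \<open>(p + 2)^2 / (3 (1 + 2 p))\<close>.\<close>

lemma legendre_isogeny:
  fixes p :: complex
  assumes p: "1 + 2 * p \<noteq> 0"
  defines "l \<equiv> p * (2 + p) ^ 3 / (1 + 2 * p) ^ 3"
    and "l' \<equiv> p ^ 3 * (2 + p) / (1 + 2 * p)"
    and "c \<equiv> 9 / (1 + 2 * p) ^ 2"
  defines "x \<equiv> (p + 2)^2 / (3 * (1 + 2 * p)) - (l + 1) / 3"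
  shows "psi3 (legendre_g2 l) (legendre_g3 l) x = 0"
    and "120 * x ^ 2 - 9 * legendre_g2 l = c ^ 2 * legendre_g2 l'"
    and "280 * x ^ 3 - 42 * legendre_g2 l * x - 27 * legendre_g3 l = c ^ 3 * legendre_g3 l'"
proof -
  \<comment> \<open>All denominators are powers of \<open>d\<close> up to constants. The numerators
    are named so that each claim reduces to a polynomial identity in \<open>p\<close>.\<close>
  define d where "d = 1 + 2 * p"
  define P where "P = p * (2 + p) ^ 3"
  define N where "N = (p + 2)^2 * d^2 - P - d ^ 3"
  define A where "A = 4 * (P^2 - P * d^3 + d^6)"
  define B where "B = 4 * ((P + d^3) * (P - 2 * d^3) * (2 * P - d^3))"
  define P' where "P' = p ^ 3 * (2 + p)"
  define A' where "A' = 4 * (P'^2 - P' * d + d^2)"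
  define B' where "B' = 4 * ((P' + d) * (P' - 2 * d) * (2 * P' - d))"
  have d: "d \<noteq> 0" using p by (simp add: d_def)
  have l: "l = P / d ^ 3" "l' = P' / d" "c = 9 / d ^ 2"
    by (simp_all add: l_def l'_def c_def P_def P'_def d_def)
  have x: "x = N / (3 * d ^ 3)" unfolding x_def l d_def[symmetric] N_def using d
    by (simp add: divide_simps) (simp add: eval_nat_numeral algebra_simps)
  have A: "legendre_g2 l = A / (3 * d ^ 6)" "legendre_g2 l' = A' / (3 * d ^ 2)"
    unfolding legendre_g2_def A_def A'_def l using d by (simp_all add: divide_simps) algebra+
  have B: "legendre_g3 l = B / (27 * d ^ 9)" "legendre_g3 l' = B' / (27 * d ^ 3)"
    unfolding legendre_g3_def B_def B'_def l using d by (simp_all add: divide_simps) algebra+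
  note defs = A_def A'_def B_def B'_def N_def P_def P'_def d_def
  have "16 * N ^ 4 - 24 * A * N ^ 2 - 16 * B * N - 3 * A ^ 2 = 0"
    unfolding defs by algebra
  moreover have "psi3 (legendre_g2 l) (legendre_g3 l) x =
      (16 * N ^ 4 - 24 * A * N ^ 2 - 16 * B * N - 3 * A ^ 2) / (27 * d ^ 12)"
    unfolding psi3_def A B x using d by (simp add: divide_simps)
  ultimately show "psi3 (legendre_g2 l) (legendre_g3 l) x = 0" by simp
  have "40 * N ^ 2 - 9 * A = 81 * A'"
    unfolding defs by algebra
  hence A': "A' = (40 * N ^ 2 - 9 * A) / 81" by simp
  show "120 * x ^ 2 - 9 * legendre_g2 l = c ^ 2 * legendre_g2 l'"
    unfolding A x A' l(3) using d by (simp add: divide_simps)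
  have "280 * N ^ 3 - 126 * A * N - 27 * B = 729 * B'"
    unfolding defs by algebra
  hence B': "B' = (280 * N ^ 3 - 126 * A * N - 27 * B) / 729" by simp
  show "280 * x ^ 3 - 42 * legendre_g2 l * x - 27 * legendre_g3 l = c ^ 3 * legendre_g3 l'"
    unfolding A B x B' l(3) using d by (simp add: divide_simps)
qed

text \<open>On a singular cubic the quartic has at most two distinct roots. Four distinct abscissas
  of order 3 will therefore exclude a vanishing discriminant.\<close>

lemma discriminant_zero_psi3:
  assumes "a ^ 3 - 27 * b ^ 2 = 0"
  shows "\<exists>e. \<forall>x. psi3 a b x = 48 * ((x - e) ^ 3 * (x + 3 * e))"
proof (cases "a = 0")
  case True
  hence "b = 0" using assms by auto
  thus ?thesis using True by (intro exI[of _ 0]) (simp add: psi3_def eval_nat_numeral)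
next
  case False
  \<comment> \<open>The double root of \<open>4 x^3 - a x - b = 4 (x - e)^2 (x + 2 e)\<close>;
    comparing coefficients gives \<open>a = 12 e^2\<close> and \<open>b = - 8 e^3\<close>.\<close>
  define e where "e = - 3 * b / (2 * a)"
  have e: "2 * a * e = - 3 * b" using False by (simp add: e_def)
  have "a ^ 2 * (a - 12 * e ^ 2) = 0" using assms e by algebra
  hence a: "a = 12 * e ^ 2" using False by auto
  hence b: "b = - 8 * e ^ 3" using e by algebra
  show ?thesis unfolding psi3_def a b by (intro exI[of _ e] allI) algebra
qed

lemma psi3_roots:
  assumes "distinct [r1, r2, r3, r4]" "\<And>r. r \<in> set [r1, r2, r3, r4] \<Longrightarrow> psi3 a b r = 0" "psi3 a b x = 0"
  shows "x \<in> set [r1, r2, r3, r4]"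
proof (rule ccontr)
  assume x: "x \<notin> set [r1, r2, r3, r4]"
  define P where "P = [:- (a ^ 2), - 48 * b, - 24 * a, 0, 48:]"
  have P: "poly P y = psi3 a b y" for y
    by (simp add: P_def psi3_def) algebra
  have "P \<noteq> 0" by (simp add: P_def)
  have "set [x, r1, r2, r3, r4] \<subseteq> {y. poly P y = 0}" using assms by (auto simp: P)
  hence "card (set [x, r1, r2, r3, r4]) \<le> card {y. poly P y = 0}"
    using poly_roots_finite[OF \<open>P \<noteq> 0\<close>] by (rule card_mono[rotated])
  also have "\<dots> \<le> degree P" by (rule card_poly_roots_bound) fact
  also have "\<dots> = 4" by (simp add: P_def)
  also have "card (set [x, r1, r2, r3, r4]) = 5"
    using distinct_card[of "[x, r1, r2, r3, r4]"] assms(1) x by simp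
  finally show False by simp
qed

section \<open>Eisenstein functions of a lattice\<close>

lemma summable_on_int_powr: "(\<lambda>m::int. (1 + \<bar>real_of_int m\<bar>) powr (-3/2)) summable_on UNIV"
proof -
  let ?f = "\<lambda>m::int. (1 + \<bar>real_of_int m\<bar>) powr (-3/2)"
  have "summable (\<lambda>n. real (Suc n) powr (-3/2))"
    by (subst summable_Suc_iff) (simp add: summable_real_powr_iff)
  hence "summable (\<lambda>n. norm ((1 + real n) powr (-3/2)))" by (simp add: add.commute)
  hence nat: "(\<lambda>n::nat. (1 + real n) powr (-3/2)) summable_on UNIV"
    by (rule norm_summable_imp_summable_on)
  have "?f summable_on range int" "?f summable_on range (\<lambda>n. - int n)"
    by (subst summable_on_reindex; use nat in \<open>simp add: inj_on_def o_def\<close>)+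
  hence "?f summable_on range int" "?f summable_on (range (\<lambda>n. - int n) - {0})"
    by (auto intro: summable_on_cofin_subset)
  hence "?f summable_on (range int \<union> (range (\<lambda>n. - int n) - {0}))"
    by (rule summable_on_Un_disjoint) auto
  also have "range int \<union> (range (\<lambda>n. - int n) - {0}) = UNIV"
  proof (intro equalityI subsetI UNIV_I)
    fix x :: int
    have "x = int (nat x) \<or> x = - int (nat (-x)) \<and> x \<noteq> 0" by linarith
    thus "x \<in> range int \<union> (range (\<lambda>n. - int n) - {0})" by (metis Un_iff Diff_iff rangeI singletonD)
  qed
  finally show ?thesis .
qed

text \<open>
  Up to constants, a lattice point is at least as large as each of its coordinates, so this product
  dominates the inverse cube of its norm.
\<close>
lemma summable_on_int_pair_powr:
  "(\<lambda>(m::int, n::int). ((1 + \<bar>real_of_int m\<bar>) * (1 + \<bar>real_of_int n\<bar>)) powr (-3/2)) summable_on UNIV"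
proof -
  let ?f = "\<lambda>m::int. (1 + \<bar>real_of_int m\<bar>) powr (-3/2)"
  have "(\<lambda>x. norm (case x of (m, n) \<Rightarrow> ?f m * ?f n)) summable_on UNIV \<times> UNIV"
    by (subst Infinite_Sum.abs_summable_on_Sigma_iff)
       (use summable_on_int_powr in \<open>auto simp: abs_mult infsum_cmult_right' intro!: summable_on_cmult_right summable_on_cmult_left\<close>)
  hence "(\<lambda>(m, n). ?f m * ?f n) summable_on UNIV"
    by (simp add: case_prod_unfold abs_mult)
  thus ?thesis by (simp add: powr_mult case_prod_unfold)
qed

text \<open>The M-test makes the finite partial sums converge uniformly on the disc, and a uniform
  limit of holomorphic functions may be differentiated termwise. Only the functions need a bound;
  summability of the derivatives at \<open>z\<close> comes out as well.\<close>

lemma has_field_derivative_infsum: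
  fixes f :: "'a \<Rightarrow> complex \<Rightarrow> complex"
  assumes r: "r > 0"
    and deriv: "\<And>a y. a \<in> A \<Longrightarrow> y \<in> cball z r \<Longrightarrow> (f a has_field_derivative f' a y) (at y)"
    and bound: "\<And>a y. a \<in> A \<Longrightarrow> y \<in> cball z r \<Longrightarrow> norm (f a y) \<le> M a"
    and M: "M summable_on A"
  shows "((\<lambda>y. \<Sum>\<^sub>\<infinity>a\<in>A. f a y) has_field_derivative (\<Sum>\<^sub>\<infinity>a\<in>A. f' a z)) (at z)"
proof -
  have ulim: "uniform_limit (cball z r) (\<lambda>X y. \<Sum>x\<in>X. f x y) (\<lambda>y. \<Sum>\<^sub>\<infinity>x\<in>A. f x y) (finite_subsets_at_top A)"
    using bound M by (rule Weierstrass_m_test_general)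
  have cont: "eventually (\<lambda>X. continuous_on (cball z r) (\<lambda>y. \<Sum>x\<in>X. f x y) \<and>
     (\<forall>w\<in>ball z r. ((\<lambda>y. \<Sum>x\<in>X. f x y) has_field_derivative (\<Sum>x\<in>X. f' x w)) (at w)))
     (finite_subsets_at_top A)"
  proof (rule eventually_finite_subsets_at_top_weakI)
    fix X assume X: "finite X" "X \<subseteq> A"
    have *: "((\<lambda>y. \<Sum>x\<in>X. f x y) has_field_derivative (\<Sum>x\<in>X. f' x w)) (at w)" if "w \<in> cball z r" for w
      using X that by (intro DERIV_sum deriv) auto
    have "continuous_on (cball z r) (\<lambda>y. \<Sum>x\<in>X. f x y)"
      by (rule DERIV_continuous_on, rule has_field_derivative_at_within, rule *)
    thus "continuous_on (cball z r) (\<lambda>y. \<Sum>x\<in>X. f x y) \<and>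
     (\<forall>w\<in>ball z r. ((\<lambda>y. \<Sum>x\<in>X. f x y) has_field_derivative (\<Sum>x\<in>X. f' x w)) (at w))"
      using * ball_subset_cball by blast
  qed
  obtain g' where
    "\<And>w. w \<in> ball z r \<Longrightarrow> ((\<lambda>y. \<Sum>\<^sub>\<infinity>x\<in>A. f x y) has_field_derivative g' w) (at w) \<and>
      ((\<lambda>X. \<Sum>x\<in>X. f' x w) \<longlongrightarrow> g' w) (finite_subsets_at_top A)"
    by (rule has_complex_derivative_uniform_limit[OF cont ulim finite_subsets_at_top_neq_bot r], rule that)
  from this[of z] r have "((\<lambda>y. \<Sum>\<^sub>\<infinity>x\<in>A. f x y) has_field_derivative g' z) (at z)"
    "((\<lambda>x. f' x z) has_sum g' z) A"
    by (auto simp: has_sum_def)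
  thus ?thesis by (simp add: infsumI)
qed

text \<open>Here \<open>f i\<close> is the i-th derivative of \<open>f 0\<close>. The remainder is
  of order \<open>z^(n+1)\<close>, so it still tends to 0 after division by \<open>z^n\<close>.
  Expansions in this form can be multiplied and compared by means of limits.\<close>

lemma Taylor_little_o:
  fixes f :: "nat \<Rightarrow> complex \<Rightarrow> complex"
  assumes r: "r > 0"
    and deriv: "\<And>i z. z \<in> ball u r \<Longrightarrow> (f i has_field_derivative f (Suc i) z) (at z)"
  shows "((\<lambda>z. (f 0 (u + z) - (\<Sum>i\<le>n. f i u * z ^ i / fact i)) / z ^ n) \<longlongrightarrow> 0) (at 0)"
proof -
  have "continuous_on (ball u r) (f (Suc n))"
    by (rule DERIV_continuous_on, rule has_field_derivative_at_within, rule deriv)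
  hence "continuous_on (cball u (r/2)) (f (Suc n))"
    by (rule continuous_on_subset) (use r in \<open>auto simp: subset_iff\<close>)
  hence "bounded (f (Suc n) ` cball u (r/2))"
    by (intro compact_imp_bounded compact_continuous_image) auto
  then obtain B where B: "\<And>z. z \<in> cball u (r/2) \<Longrightarrow> norm (f (Suc n) z) \<le> B"
    unfolding bounded_iff by blast
  have "norm ((f 0 (u + z) - (\<Sum>i\<le>n. f i u * z ^ i / fact i)) / z ^ n) \<le> \<bar>B\<bar> * norm z"
    if z: "z \<noteq> 0" "norm z < r / 2" for z
  proof -
    have "norm (f 0 (u + z) - (\<Sum>i\<le>n. f i u * (u + z - u) ^ i / fact i))
       \<le> B * norm (u + z - u) ^ Suc n / fact n"
      by (rule complex_Taylor[where S = "cball u (r/2)"])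
         (use B r z in \<open>auto intro!: DERIV_subset[OF deriv] simp: dist_norm\<close>)
    also have "\<dots> \<le> \<bar>B\<bar> * norm z ^ Suc n / 1"
      by (rule frac_le, simp, simp only: add_diff_cancel_left', rule mult_right_mono) (auto simp: fact_ge_1)
    finally show ?thesis using z by (simp add: norm_divide norm_power field_simps)
  qed
  hence "\<forall>\<^sub>F z in at 0. norm ((f 0 (u + z) - (\<Sum>i\<le>n. f i u * z ^ i / fact i)) / z ^ n) \<le> \<bar>B\<bar> * norm z"
    unfolding eventually_at by (intro exI[of _ "r/2"]) (use r in auto)
  moreover have "((\<lambda>z::complex. \<bar>B\<bar> * norm z) \<longlongrightarrow> 0) (at 0)"
    by (auto intro!: tendsto_eq_intros)
  ultimately show ?thesis by (rule Lim_null_comparison)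
qed

section \<open>Lattice points and Eisenstein functions\<close>

locale complex_lattice =
  fixes \<tau> :: complex
  assumes Im_tau: "Im \<tau> > 0"
begin

definition pt :: "int \<times> int \<Rightarrow> complex" where
  "pt a = of_int (fst a) * \<tau> + of_int (snd a)"

lemma pt_add: "pt (a + b) = pt a + pt b"
  and pt_minus: "pt (- a) = - pt a"
  and pt_diff: "pt (a - b) = pt a - pt b"
  by (simp_all add: pt_def algebra_simps)

lemma pt_0 [simp]: "pt 0 = 0"
  by (simp add: pt_def)

lemma pt_eq_0_iff: "pt a = 0 \<longleftrightarrow> a = 0"
proof
  assume *: "pt a = 0"
  hence "Im (pt a) = 0" by simp
  hence "fst a = 0" using Im_tau by (simp add: pt_def)
  thus "a = 0" using * by (simp add: pt_def prod_eq_iff)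
qed auto

lemma pt_eq_iff: "pt a = pt b \<longleftrightarrow> a = b"
  using pt_eq_0_iff[of "a - b"] by (simp add: pt_diff)

lemma pt_lower_bound:
  obtains C where "C > 0" "\<And>a. a \<noteq> 0 \<Longrightarrow> 1 + \<bar>real_of_int (fst a)\<bar> \<le> C * norm (pt a)"
    "\<And>a. a \<noteq> 0 \<Longrightarrow> 1 + \<bar>real_of_int (snd a)\<bar> \<le> C * norm (pt a)"
proof
  \<comment> \<open>\<open>Im (pt a)\<close> bounds the first coordinate by
    \<open>norm (pt a) / Im \<tau>\<close>, and the triangle inequality then bounds the second;
    \<open>D\<close> serves for both. For \<open>a\<close> nonzero some coordinate is at least 1 in
    absolute value, which pays for the extra 1 and doubles the constant.\<close>
  define D where "D = 1 + (1 + norm \<tau>) / Im \<tau>"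
  have D: "D > 0" using Im_tau by (auto simp: D_def intro!: add_pos_nonneg divide_nonneg_pos)
  have 1: "\<bar>real_of_int (fst a)\<bar> \<le> norm (pt a) / Im \<tau>" for a
  proof -
    have "\<bar>real_of_int (fst a)\<bar> * Im \<tau> = \<bar>Im (pt a)\<bar>"
      using Im_tau by (simp add: pt_def abs_mult)
    also have "\<dots> \<le> norm (pt a)" by (rule abs_Im_le_cmod)
    finally show ?thesis using Im_tau by (simp add: field_simps)
  qed
  have 2: "\<bar>real_of_int (snd a)\<bar> \<le> norm (pt a) + norm (pt a) / Im \<tau> * norm \<tau>" for a
  proof -
    have "\<bar>real_of_int (snd a)\<bar> = norm (pt a - of_int (fst a) * \<tau>)"
      by (simp add: pt_def)
    also have "\<dots> \<le> norm (pt a) + \<bar>real_of_int (fst a)\<bar> * norm \<tau>"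
      by (rule order_trans[OF norm_triangle_ineq4]) (simp add: norm_mult)
    also have "\<dots> \<le> norm (pt a) + norm (pt a) / Im \<tau> * norm \<tau>"
      by (intro add_left_mono mult_right_mono 1) auto
    finally show ?thesis .
  qed
  have D1: "\<bar>real_of_int (fst a)\<bar> \<le> D * norm (pt a)" for a
    by (rule order_trans[OF 1]) (use Im_tau in \<open>auto simp: D_def field_simps intro!: add_nonneg_nonneg\<close>)
  have D2: "\<bar>real_of_int (snd a)\<bar> \<le> D * norm (pt a)" for a
    by (rule order_trans[OF 2]) (use Im_tau in \<open>auto simp: D_def field_simps intro!: add_nonneg_nonneg\<close>)
  have D3: "1 \<le> D * norm (pt a)" if "a \<noteq> 0" for a
  proof -
    have "fst a \<noteq> 0 \<or> snd a \<noteq> 0" using that by (auto simp: prod_eq_iff)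
    hence "1 \<le> \<bar>real_of_int (fst a)\<bar> \<or> 1 \<le> \<bar>real_of_int (snd a)\<bar>" by linarith
    thus ?thesis using D1[of a] D2[of a] by linarith
  qed
  show "2 * D > 0" using D by simp
  show "1 + \<bar>real_of_int (fst a)\<bar> \<le> 2 * D * norm (pt a)"
       "1 + \<bar>real_of_int (snd a)\<bar> \<le> 2 * D * norm (pt a)" if "a \<noteq> 0" for a
    using D1[of a] D2[of a] D3[OF that] by linarith+
qed

lemma finite_pt_norm_less: "finite {a. norm (pt a) < R}"
proof -
  obtain C where C: "C > 0" "\<And>a. a \<noteq> 0 \<Longrightarrow> 1 + \<bar>real_of_int (fst a)\<bar> \<le> C * norm (pt a)"
    "\<And>a. a \<noteq> 0 \<Longrightarrow> 1 + \<bar>real_of_int (snd a)\<bar> \<le> C * norm (pt a)"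
    by (rule pt_lower_bound, rule that)
  define N where "N = \<lceil>C * R\<rceil>"
  have "a \<in> insert 0 ({-N..N} \<times> {-N..N})" if "norm (pt a) < R" for a
  proof (cases "a = 0")
    case False
    have "C * norm (pt a) \<le> C * R" using that C(1) by simp
    hence "\<bar>real_of_int (fst a)\<bar> \<le> of_int N" "\<bar>real_of_int (snd a)\<bar> \<le> of_int N"
      using C(2,3)[OF False] unfolding N_def by linarith+
    thus ?thesis by (cases a) (auto simp: abs_le_iff)
  qed auto
  hence "{a. norm (pt a) < R} \<subseteq> insert 0 ({-N..N} \<times> {-N..N})" by blast
  thus ?thesis by (rule finite_subset) simp
qed

lemma summable_on_pt_power:
  assumes "k \<ge> 3"
  shows "(\<lambda>a. 1 / norm (pt a) ^ k) summable_on UNIV"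
proof -
  obtain C where C: "C > 0" "\<And>a. a \<noteq> 0 \<Longrightarrow> 1 + \<bar>real_of_int (fst a)\<bar> \<le> C * norm (pt a)"
    "\<And>a. a \<noteq> 0 \<Longrightarrow> 1 + \<bar>real_of_int (snd a)\<bar> \<le> C * norm (pt a)"
    by (rule pt_lower_bound, rule that)
  let ?g = "\<lambda>a::int \<times> int. C ^ k * ((1 + \<bar>real_of_int (fst a)\<bar>) * (1 + \<bar>real_of_int (snd a)\<bar>)) powr (-3/2)"
  have le: "1 / norm (pt a) ^ k \<le> ?g a" for a
  proof (cases "a = 0")
    case True
    thus ?thesis using C(1) assms by (auto simp: power_0_left intro!: mult_nonneg_nonneg)
  next
    case False
    \<comment> \<open>\<open>s\<close> dominates both factors of the summable product, so
      \<open>s^(-3) = (s * s)^(-3/2)\<close> lies below it; \<open>s >= 1\<close> reduces every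
      \<open>k >= 3\<close> to the exponent 3.\<close>
    define s where "s = C * norm (pt a)"
    have s: "1 + \<bar>real_of_int (fst a)\<bar> \<le> s" "1 + \<bar>real_of_int (snd a)\<bar> \<le> s" "s \<ge> 1"
      using C(2,3)[OF False] by (auto simp: s_def)
    have "s powr -3 = (s * s) powr (-3/2)"
      using s by (simp add: powr_mult flip: powr_add)
    also have "\<dots> \<le> ((1 + \<bar>real_of_int (fst a)\<bar>) * (1 + \<bar>real_of_int (snd a)\<bar>)) powr (-3/2)"
      using s by (intro powr_mono2' mult_mono mult_pos_pos) auto
    finally have "s powr -3 \<le> ((1 + \<bar>real_of_int (fst a)\<bar>) * (1 + \<bar>real_of_int (snd a)\<bar>)) powr (-3/2)" .
    moreover have "1 / s ^ k \<le> s powr -3"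
    proof -
      have "1 / s ^ k \<le> 1 / s ^ 3" using s assms by (intro divide_left_mono power_increasing mult_pos_pos) auto
      also have "\<dots> = s powr -3" using s by (simp add: powr_minus field_simps)
      finally show ?thesis .
    qed
    ultimately have "C ^ k * (1 / s ^ k) \<le> ?g a" using C(1) by (intro mult_left_mono) auto
    also have "C ^ k * (1 / s ^ k) = 1 / norm (pt a) ^ k"
      using C(1) by (simp add: s_def power_mult_distrib)
    finally show ?thesis .
  qed
  have "?g summable_on UNIV"
    using summable_on_int_pair_powr by (intro summable_on_cmult_right) (simp add: case_prod_unfold)
  thus ?thesis
    by (rule summable_on_comparison_test) (use le in auto)
qed

text \<open>
  Since \<open>1 / 0 = 0\<close>, the term at \<open>pt a = - z\<close> drops out: \<open>eis k 0\<close> is the Eisenstein series over the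
  nonzero lattice points, and the correction in \<open>eis 2 = \<wp>\<close> is absent for \<open>a = 0\<close>.
\<close>
definition eis_term :: "nat \<Rightarrow> complex \<Rightarrow> int \<times> int \<Rightarrow> complex" where
  "eis_term k z a = 1 / (z + pt a) ^ k - (if k = 2 then 1 / pt a ^ 2 else 0)"

definition eis :: "nat \<Rightarrow> complex \<Rightarrow> complex" where
  "eis k z = (\<Sum>\<^sub>\<infinity>a. eis_term k z a)"

definition eis' :: "nat \<Rightarrow> complex \<Rightarrow> complex" where
  "eis' k z = (\<Sum>\<^sub>\<infinity>a\<in>-{0}. eis_term k z a)"

text \<open>For \<open>norm w >= 2 R\<close> the norm of \<open>z + w\<close> is at least half that
  of \<open>w\<close>. For \<open>k = 2\<close> the correction gains one power of \<open>w\<close>,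
  since the difference is \<open>- z (2 w + z) / ((z + w)^2 w^2)\<close>; hence the exponent
  \<open>max k 3\<close>. The constant covers both cases.\<close>

lemma norm_eis_term_le:
  assumes "R > 0" "norm z \<le> R" "norm (pt a) \<ge> 2 * R" "k \<ge> 2"
  shows "norm (eis_term k z a) \<le> (2 ^ k + 10 * R) * (1 / norm (pt a) ^ max k 3)"
proof -
  define w where "w = pt a"
  have w: "norm w > 0" "w \<noteq> 0" using assms by (auto simp: w_def)
  have "norm w - norm z \<le> norm (z + w)"
    using norm_triangle_ineq4[of "z + w" z] by simp
  hence zw: "norm (z + w) \<ge> norm w / 2" using assms by (auto simp: w_def)
  hence zw0: "z + w \<noteq> 0" using w by auto
  show ?thesis
  proof (cases "k = 2")
    case False
    hence "norm (eis_term k z a) = 1 / norm (z + w) ^ k"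
      by (simp add: eis_term_def w_def norm_divide norm_power)
    also have "\<dots> \<le> 1 / (norm w / 2) ^ k"
      using w zw by (intro divide_left_mono power_mono mult_pos_pos zero_less_power) auto
    also have "\<dots> = 2 ^ k * (1 / norm w ^ k)"
      by (simp add: power_divide)
    also have "\<dots> \<le> (2 ^ k + 10 * R) * (1 / norm w ^ k)"
      using assms by (intro mult_right_mono) auto
    also have "norm w ^ k = norm (pt a) ^ max k 3"
      using False assms by (simp add: w_def max_absorb1)
    finally show ?thesis .
  next
    case True
    have "eis_term k z a = - (z * (2 * w + z)) / ((z + w) ^ 2 * w ^ 2)"
    proof -
      have "w ^ 2 - (z + w) ^ 2 = - (z * (2 * w + z))" by (simp add: power2_eq_square algebra_simps)
      moreover have "1 / (z + w) ^ 2 - 1 / w ^ 2 = (w ^ 2 - (z + w) ^ 2) / ((z + w) ^ 2 * w ^ 2)"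
        using w zw0 by (subst diff_frac_eq) auto
      ultimately show ?thesis using True by (simp only: eis_term_def w_def simp_thms if_True)
    qed
    hence "norm (eis_term k z a) = norm z * norm (2 * w + z) / (norm (z + w) ^ 2 * norm w ^ 2)"
      by (simp add: norm_divide norm_mult norm_power)
    also have "\<dots> \<le> (R * (5 / 2 * norm w)) / ((norm w / 2) ^ 2 * norm w ^ 2)"
    proof (intro frac_le mult_mono power_mono zw assms)
      have "norm (2 * w + z) \<le> 2 * norm w + norm z"
        by (rule order_trans[OF norm_triangle_ineq]) (simp add: norm_mult)
      thus "norm (2 * w + z) \<le> 5 / 2 * norm w" using assms by (auto simp: w_def)
    qed (use w assms in auto)
    also have "\<dots> = 10 * R * (1 / norm w ^ 3)"
      using w by (simp add: field_simps eval_nat_numeral)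
    also have "\<dots> \<le> (2 ^ k + 10 * R) * (1 / norm w ^ 3)"
      using assms by (intro mult_right_mono) auto
    finally show ?thesis using True by (simp add: w_def)
  qed
qed

lemma eis_term_deriv:
  assumes "z + pt a \<noteq> 0" "k \<ge> 2"
  shows "((\<lambda>z. eis_term k z a) has_field_derivative (- of_nat k * eis_term (Suc k) z a)) (at z)"
proof -
  obtain m where m: "k = Suc m" using assms by (cases k) auto
  define y where "y = z + pt a"
  have "((\<lambda>z. (z + pt a) ^ Suc m) has_field_derivative (1 + of_nat m) * (1 * y ^ m)) (at z)"
    unfolding y_def by (rule DERIV_power_Suc) (auto intro!: derivative_eq_intros)
  from DERIV_inverse_fun[OF this] assms(1)
  have "((\<lambda>z. inverse ((z + pt a) ^ k)) has_field_derivative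
      - (((1 + of_nat m) * (1 * y ^ m)) * inverse ((y ^ k) ^ Suc (Suc 0)))) (at z)"
    by (simp add: m y_def)
  moreover have "- (((1 + of_nat m) * (1 * y ^ m)) * inverse ((y ^ k) ^ Suc (Suc 0))) = - of_nat k * (1 / y ^ Suc k)"
    using assms(1) by (simp add: m y_def[symmetric] divide_simps)
  ultimately have "((\<lambda>z. inverse ((z + pt a) ^ k)) has_field_derivative (- of_nat k * (1 / y ^ Suc k))) (at z)"
    by (simp only:)
  hence "((\<lambda>z. 1 / (z + pt a) ^ k - c) has_field_derivative (- of_nat k * (1 / (z + pt a) ^ Suc k))) (at z)" for c
    using DERIV_diff[OF _ DERIV_const[of c]] by (fastforce simp: inverse_eq_divide y_def)
  from this[of "if k = 2 then 1 / pt a ^ 2 else 0"] show ?thesis using assms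
    by (simp add: eis_term_def)
qed

text \<open>Without the lattice points of norm below \<open>2 R\<close> the series has no pole in
  the disc of radius \<open>R\<close> and is dominated there by \<open>norm_eis_term_le\<close>. The
  finitely many omitted terms are restored through \<open>eis_split\<close>.\<close>

lemma eis_tail:
  assumes R: "R > 0" and F: "\<And>a. a \<notin> F \<Longrightarrow> norm (pt a) \<ge> 2 * R" and z: "norm z < R" and k: "k \<ge> 2"
  shows "eis_term k z summable_on - F"
    and "((\<lambda>z. \<Sum>\<^sub>\<infinity>a\<in>-F. eis_term k z a) has_field_derivative
            (- of_nat k * (\<Sum>\<^sub>\<infinity>a\<in>-F. eis_term (Suc k) z a))) (at z)"
proof -
  define M where "M = (\<lambda>a. (2 ^ k + 10 * R) * (1 / norm (pt a) ^ max k 3))"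
  have M: "M summable_on - F" unfolding M_def
    by (intro summable_on_cmult_right summable_on_subset_banach[OF summable_on_pt_power]) auto
  have le: "norm (eis_term k y a) \<le> M a" if "norm y \<le> R" "a \<notin> F" for y a
    unfolding M_def using norm_eis_term_le[OF R that(1) F[OF that(2)] k] .
  have "(\<lambda>a. norm (eis_term k z a)) summable_on - F"
    by (rule summable_on_comparison_test[OF M]) (use le z in auto)
  thus "eis_term k z summable_on - F"
    by (rule Infinite_Sum.abs_summable_summable)
  have "((\<lambda>z. \<Sum>\<^sub>\<infinity>a\<in>-F. eis_term k z a) has_field_derivative
            (\<Sum>\<^sub>\<infinity>a\<in>-F. - of_nat k * eis_term (Suc k) z a)) (at z)"
  proof (rule has_field_derivative_infsum[where r = "R - norm z", OF _ _ _ M])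
    fix a y assume a: "a \<in> - F" and y: "y \<in> cball z (R - norm z)"
    have "norm y \<le> norm z + norm (y - z)" by (rule norm_triangle_sub)
    hence y: "norm y \<le> R" using y by (simp add: dist_norm norm_minus_commute)
    show "norm (eis_term k y a) \<le> M a" using le a y by auto
    have "y + pt a \<noteq> 0"
    proof
      assume "y + pt a = 0"
      hence "norm (pt a) = norm y" by (metis add_eq_0_iff norm_minus_cancel)
      thus False using y F[of a] a R by auto
    qed
    thus "((\<lambda>z. eis_term k z a) has_field_derivative (- of_nat k * eis_term (Suc k) y a)) (at y)"
      using k by (rule eis_term_deriv)
  qed (use z in auto)
  thus "((\<lambda>z. \<Sum>\<^sub>\<infinity>a\<in>-F. eis_term k z a) has_field_derivative
            (- of_nat k * (\<Sum>\<^sub>\<infinity>a\<in>-F. eis_term (Suc k) z a))) (at z)"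
    by (simp only: infsum_cmult_right')
qed

lemma eis_term_summable:
  assumes "k \<ge> 2"
  shows "eis_term k z summable_on A"
proof -
  define F where "F = {a. norm (pt a) < 2 * (norm z + 1)}"
  have "eis_term k z summable_on - F"
    by (rule eis_tail(1)[of "norm z + 1"]) (use assms in \<open>auto simp: F_def add_nonneg_pos\<close>)
  moreover have "finite F" unfolding F_def by (rule finite_pt_norm_less)
  ultimately have "eis_term k z summable_on (F \<union> - F)"
    by (intro summable_on_Un_disjoint) auto
  thus ?thesis by (rule summable_on_subset_banach) auto
qed

lemma eis_split:
  assumes "k \<ge> 2" "finite F"
  shows "eis k z = sum (eis_term k z) F + (\<Sum>\<^sub>\<infinity>a\<in>-F. eis_term k z a)"
proof -
  have "(\<Sum>\<^sub>\<infinity>a\<in>F \<union> -F. eis_term k z a) = infsum (eis_term k z) F + infsum (eis_term k z) (-F)"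
    by (rule infsum_Un_disjoint) (use assms eis_term_summable in auto)
  thus ?thesis using assms by (simp add: eis_def)
qed

lemma eis_deriv:
  assumes "z \<notin> range pt" "k \<ge> 2"
  shows "(eis k has_field_derivative (- of_nat k * eis (Suc k) z)) (at z)"
proof -
  define F where "F = {a. norm (pt a) < 2 * (norm z + 1)}"
  have fin: "finite F" unfolding F_def by (rule finite_pt_norm_less)
  have nz: "z + pt a \<noteq> 0" for a
    using assms(1) by (metis add_eq_0_iff2 pt_minus rangeI)
  have "((\<lambda>z. sum (eis_term k z) F + (\<Sum>\<^sub>\<infinity>a\<in>-F. eis_term k z a)) has_field_derivative
     (\<Sum>a\<in>F. - of_nat k * eis_term (Suc k) z a) + (- of_nat k * (\<Sum>\<^sub>\<infinity>a\<in>-F. eis_term (Suc k) z a))) (at z)"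
    by (intro DERIV_add DERIV_sum eis_term_deriv nz assms eis_tail(2)[of "norm z + 1"])
       (auto simp: F_def add_nonneg_pos)
  also have "(\<lambda>z. sum (eis_term k z) F + (\<Sum>\<^sub>\<infinity>a\<in>-F. eis_term k z a)) = eis k"
    using eis_split[OF assms(2) fin] by auto
  also have "(\<Sum>a\<in>F. - of_nat k * eis_term (Suc k) z a) + (- of_nat k * (\<Sum>\<^sub>\<infinity>a\<in>-F. eis_term (Suc k) z a))
     = - of_nat k * eis (Suc k) z"
    using assms by (subst eis_split[OF _ fin]) (auto simp: sum_distrib_left algebra_simps)
  finally show ?thesis .
qed

lemma eis_eq_eis':
  fixes z :: complex
  assumes "k \<ge> 2"
  shows "eis k z = 1 / z ^ k + eis' k z"
  using eis_split[of k "{0}" z] assms by (auto simp: eis'_def eis_term_def)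

lemma eis'_0: "k \<ge> 2 \<Longrightarrow> eis' k 0 = eis k 0"
  by (simp add: eis_eq_eis' power_0_left)

lemma eis'_deriv:
  obtains r where "r > 0" "\<And>k z. k \<ge> 2 \<Longrightarrow> z \<in> ball 0 r \<Longrightarrow>
     (eis' k has_field_derivative (- of_nat k * eis' (Suc k) z)) (at z)"
proof -
  obtain C where C: "C > 0" "\<And>a. a \<noteq> 0 \<Longrightarrow> 1 + \<bar>real_of_int (fst a)\<bar> \<le> C * norm (pt a)"
    "\<And>a. a \<noteq> 0 \<Longrightarrow> 1 + \<bar>real_of_int (snd a)\<bar> \<le> C * norm (pt a)"
    by (rule pt_lower_bound, rule that)
  show ?thesis
  \<comment> \<open>Every nonzero lattice point has norm at least \<open>1 / C\<close>, twice this
    radius, so only the index 0 has to be removed and one disc serves all \<open>k\<close>.\<close>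
  proof (rule that[of "1 / (2 * C)"])
    show "1 / (2 * C) > 0" using C(1) by simp
    fix k :: nat and z :: complex
    assume kz: "k \<ge> 2" "z \<in> ball 0 (1 / (2 * C))"
    have "norm (pt a) \<ge> 2 * (1 / (2 * C))" if "a \<notin> {0}" for a
      using C(2)[of a] that C(1) by (simp add: field_simps)
    from eis_tail(2)[of "1 / (2 * C)" "{0}" z k, OF _ this _ kz(1)] kz C(1)
    show "(eis' k has_field_derivative (- of_nat k * eis' (Suc k) z)) (at z)"
      by (simp add: eis'_def[abs_def])
  qed
qed

lemma eis_minus: "eis k (- z) = (-1) ^ k * eis k z"
proof -
  have "eis k (-z) = (\<Sum>\<^sub>\<infinity>a. eis_term k (-z) (- a))"
    unfolding eis_def by (rule infsum_reindex_bij_witness[of _ uminus uminus]) auto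
  also have "(\<lambda>a. eis_term k (-z) (-a)) = (\<lambda>a. (-1) ^ k * eis_term k z a)"
  proof
    fix a have "(- z + pt (- a)) ^ k = (-1) ^ k * (z + pt a) ^ k"
      unfolding pt_minus by (metis minus_add_distrib power_minus)
    thus "eis_term k (-z) (-a) = (-1) ^ k * eis_term k z a"
      by (auto simp: eis_term_def pt_minus minus_one_power_iff)
  qed
  finally show ?thesis by (simp add: eis_def infsum_cmult_right')
qed

lemma eis_odd_0: "odd k \<Longrightarrow> eis k 0 = 0"
  using eis_minus[of k 0] by simp

lemma eis_2_0: "eis 2 0 = 0"
  by (simp add: eis_def eis_term_def)

section \<open>Topology of the lattice and periodicity\<close>

lemma countable_range_pt: "countable (range pt)"
  by (intro countable_image) auto

lemma eventually_not_in_range_pt: "\<forall>\<^sub>F z in at u. z \<notin> range pt"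
proof -
  have "finite (pt ` {a. norm (pt a) < norm u + 1})"
    by (intro finite_imageI finite_pt_norm_less)
  hence "\<forall>\<^sub>F z in at u. z \<notin> pt ` {a. norm (pt a) < norm u + 1}"
    using islimpt_iff_eventually islimpt_finite by blast
  moreover have "\<forall>\<^sub>F z in at u. z \<in> ball u 1"
    by (rule eventually_at_in_open') auto
  ultimately show ?thesis
  proof eventually_elim
    case (elim z)
    have "norm z \<le> norm u + norm (z - u)" by (rule norm_triangle_sub)
    hence "norm z < norm u + 1" using elim(2) by (simp add: dist_norm norm_minus_commute)
    thus ?case using elim(1) by auto
  qed
qed

lemma open_compl_range_pt: "open (- range pt)"
  using eventually_not_in_range_pt closed_limpt islimpt_iff_eventually by (metis open_closed double_compl)

lemma connected_compl_range_pt: "connected (- range pt)"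
  using connected_open_diff_countable[of UNIV "range pt"] countable_range_pt
  by (simp add: Compl_eq_Diff_UNIV connected_UNIV)

lemma range_pt_add_iff: "z + pt b \<in> range pt \<longleftrightarrow> z \<in> range pt"
proof
  assume "z + pt b \<in> range pt"
  then obtain a where "z + pt b = pt a" by auto
  hence "z = pt (a - b)" by (simp add: pt_diff algebra_simps)
  thus "z \<in> range pt" by simp
qed (auto simp flip: pt_add)

lemma range_pt_minus_iff: "- z \<in> range pt \<longleftrightarrow> z \<in> range pt"
proof
  assume "- z \<in> range pt"
  then obtain a where "- z = pt a" by auto
  hence "z = pt (- a)" by (metis minus_minus pt_minus)
  thus "z \<in> range pt" by simp
qed (auto simp flip: pt_minus)

lemma eis_periodic:
  assumes "k \<ge> 3"
  shows "eis k (z + pt b) = eis k z"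
  unfolding eis_def
  by (rule infsum_reindex_bij_witness[of _ "\<lambda>a. a - b" "\<lambda>a. a + b"])
     (use assms in \<open>auto simp: eis_term_def pt_add algebra_simps\<close>)

text \<open>Translation by a lattice point changes \<open>eis 2\<close> by a constant \<open>c\<close>, and comparing with
  the translation by the opposite point, \<open>eis 2\<close> being even, gives \<open>c = - c\<close>.\<close>
lemma eis_2_periodic:
  assumes "z \<notin> range pt"
  shows "eis 2 (z + pt b) = eis 2 z"
proof -
  let ?f = "\<lambda>z. eis 2 (z + pt b) - eis 2 z"
  have d: "(?f has_field_derivative 0) (at y)" if "y \<in> - range pt" for y
  proof -
    have "(?f has_field_derivative (- of_nat 2 * eis (Suc 2) (y + pt b)) * (1 + 0) - (- of_nat 2 * eis (Suc 2) y)) (at y)"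
      using that range_pt_add_iff
      by (intro DERIV_diff DERIV_chain2[of "eis 2"] eis_deriv DERIV_add DERIV_ident DERIV_const) auto
    thus ?thesis by (simp add: eis_periodic)
  qed
  have "?f constant_on (- range pt)"
    by (rule has_field_derivative_0_imp_constant_on[OF d connected_compl_range_pt open_compl_range_pt])
  then obtain c where c: "?f y = c" if "y \<in> - range pt" for y
    unfolding constant_on_def by blast
  have "- z - pt b \<notin> range pt"
    using assms range_pt_add_iff[of z b] range_pt_minus_iff[of "z + pt b"] by simp
  have even: "eis 2 (- y) = eis 2 y" for y using eis_minus[of 2 y] by simp
  from c[of "- z - pt b"] \<open>- z - pt b \<notin> range pt\<close> have "eis 2 (- z) - eis 2 (- (z + pt b)) = c" by simp
  moreover have "eis 2 (z + pt b) - eis 2 z = c" using c assms by simp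
  ultimately have "c = - c" unfolding even by (metis minus_diff_eq)
  hence "c = 0" by simp
  thus ?thesis using c[of z] assms by simp
qed

section \<open>Liouville's theorem and differential equations\<close>

lemma lattice_reduction: "\<exists>b. norm (z - pt b) \<le> 1 + norm \<tau>"
proof -
  define s where "s = Im z / Im \<tau>"
  define m where "m = \<lfloor>s\<rfloor>"
  define r where "r = Re (z - of_real s * \<tau>)"
  define n where "n = \<lfloor>r\<rfloor>"
  have "Im (z - of_real s * \<tau>) = 0" using Im_tau by (simp add: s_def)
  hence "z - of_real s * \<tau> = of_real r" by (simp add: complex_eq_iff r_def)
  hence z: "z = of_real s * \<tau> + of_real r" by (simp add: algebra_simps)
  have "z - pt (m, n) = of_real (r - of_int n) + of_real (s - of_int m) * \<tau>"
    by (simp add: z pt_def algebra_simps)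
  also have "norm \<dots> \<le> \<bar>r - of_int n\<bar> + \<bar>s - of_int m\<bar> * norm \<tau>"
    by (rule order_trans[OF norm_triangle_ineq]) (simp only: norm_mult norm_of_real order_refl)
  also have "\<bar>r - of_int n\<bar> \<le> 1" unfolding n_def by linarith
  also have "\<bar>s - of_int m\<bar> \<le> 1" unfolding m_def by linarith
  finally have "norm (z - pt (m, n)) \<le> 1 + 1 * norm \<tau>" by (simp add: mult_right_mono)
  thus ?thesis by (intro exI[of _ "(m, n)"]) simp
qed

text \<open>Periodicity carries the limit at 0 to every point of \<open>D\<close>, so all
  singularities are removable. The resulting entire function takes all its values on a compact disc
  and is constant by Liouville. The group \<open>D\<close> is kept general because it is needed both
  for the lattice and for its extension by a point of order 3.\<close>

lemma elliptic_constant: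
  assumes D: "range pt \<subseteq> D" "\<And>p q. p \<in> D \<Longrightarrow> q \<in> D \<Longrightarrow> p - q \<in> D"
    and discrete: "\<And>z. \<forall>\<^sub>F y in at z. y \<notin> D"
    and f: "f holomorphic_on - D" "\<And>z p. z \<notin> D \<Longrightarrow> p \<in> D \<Longrightarrow> f (z + p) = f z"
    and lim: "(f \<longlongrightarrow> a) (at 0)"
    and z: "z \<notin> D"
  shows "f z = a"
proof -
  define g where "g = (\<lambda>z. if z \<in> D then a else f z)"
  have D0: "0 \<in> D" using D(1) pt_0 by (metis rangeI subsetD)
  have Dm: "- p \<in> D" if "p \<in> D" for p using D(2)[OF D0 that] by simp
  have Dp: "p + q \<in> D" if "p \<in> D" "q \<in> D" for p q using D(2)[OF that(1) Dm[OF that(2)]] by simp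
  have Dp_iff: "z + p \<in> D \<longleftrightarrow> z \<in> D" if "p \<in> D" for z p
    using Dp[of z p] D(2)[of "z + p" p] that by auto
  have g_per: "g (z + p) = g z" if "p \<in> D" for z p
    using that by (simp add: g_def Dp_iff f(2))
  have lim_g0: "(g \<longlongrightarrow> g 0) (at 0)"
  proof -
    have "(f \<longlongrightarrow> g 0) (at 0)" using lim D0 by (simp add: g_def)
    moreover have "\<forall>\<^sub>F y in at 0. f y = g y"
      using discrete[of 0] by eventually_elim (simp add: g_def)
    ultimately show ?thesis by (rule Lim_transform_eventually)
  qed
  have lim_g: "(g \<longlongrightarrow> g p) (at p)" if "p \<in> D" for p
  proof -
    have "((\<lambda>h. g (p + h)) \<longlongrightarrow> g p) (at 0)"
      using lim_g0 g_per[OF that] that D0 by (simp add: add.commute g_def)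
    thus ?thesis by (simp add: LIM_offset_zero_iff)
  qed
  have openD: "open (- D)"
    using discrete closed_limpt islimpt_iff_eventually by (metis open_closed double_compl)
  have "g field_differentiable at w" for w
  proof (cases "w \<in> D")
    case False
    have "g holomorphic_on - D"
      using f(1) by (rule holomorphic_transform) (simp add: g_def)
    thus ?thesis using openD False by (simp add: holomorphic_on_imp_differentiable_at)
  next
    case True
    obtain r where r: "r > 0" "\<And>y. y \<noteq> w \<Longrightarrow> dist y w < r \<Longrightarrow> y \<notin> D"
      using discrete[of w] unfolding eventually_at by blast
    have "g holomorphic_on ball w r"
    proof (rule no_isolated_singularity')
      show "g holomorphic_on ball w r - {w}"
        using f(1) by (rule holomorphic_transform[OF holomorphic_on_subset])
          (use r in \<open>auto simp: g_def dist_commute\<close>)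
      show "(g \<longlongrightarrow> g y) (at y within ball w r)" if "y \<in> {w}" for y
        using lim_g[OF True] that by (auto intro: tendsto_within_subset)
    qed auto
    thus ?thesis using r(1) by (meson centre_in_ball holomorphic_on_imp_differentiable_at open_ball)
  qed
  hence holo: "g holomorphic_on UNIV" by (simp add: holomorphic_on_def)
  have "bounded (g ` cball 0 (1 + norm \<tau>))"
    using holo by (intro compact_imp_bounded compact_continuous_image holomorphic_on_imp_continuous_on)
      (auto intro: holomorphic_on_subset)
  moreover have "range g \<subseteq> g ` cball 0 (1 + norm \<tau>)"
  proof safe
    fix w
    obtain b where b: "norm (w - pt b) \<le> 1 + norm \<tau>" using lattice_reduction by blast
    have "g w = g (w - pt b)" using g_per[of "pt b" "w - pt b"] D(1) by auto
    thus "g w \<in> g ` cball 0 (1 + norm \<tau>)" using b by auto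
  qed
  ultimately have "g constant_on UNIV"
    using holo bounded_subset by (intro Liouville_theorem) auto
  hence "g z = g 0" by (auto simp: constant_on_def)
  thus ?thesis using z D0 by (simp add: g_def)
qed

section \<open>Expansions and the differential equations of the Weierstrass function\<close>

lemma eis_2_expansion:
  assumes "u \<notin> range pt"
  shows "((\<lambda>z. (eis 2 (u + z) - (\<Sum>i\<le>n. (-1) ^ i * of_nat (Suc i) * eis (i + 2) u * z ^ i)) / z ^ n)
    \<longlongrightarrow> 0) (at 0)"
proof -
  obtain r where r: "r > 0" "ball u r \<subseteq> - range pt"
    using assms open_compl_range_pt openE by blast
  \<comment> \<open>Repeated use of \<open>eis_deriv\<close> identifies this as the i-th derivative
    of \<open>eis 2\<close>; division by \<open>fact i\<close> leaves the coefficient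
    \<open>(-1)^i (i + 1)\<close>.\<close>
  define f where "f = (\<lambda>i z. (-1) ^ i * fact (Suc i) * eis (i + 2) z)"
  have "(f i has_field_derivative f (Suc i) z) (at z)" if "z \<in> ball u r" for i z
  proof -
    have "(f i has_field_derivative (-1) ^ i * fact (Suc i) * (- of_nat (i + 2) * eis (Suc (i + 2)) z)) (at z)"
      unfolding f_def using r that by (intro DERIV_cmult eis_deriv) auto
    also have "(-1) ^ i * fact (Suc i) * (- of_nat (i + 2) * eis (Suc (i + 2)) z) = f (Suc i) z"
      by (simp add: f_def algebra_simps)
    finally show ?thesis .
  qed
  from Taylor_little_o[where f = f and r = r and n = n, OF r(1) this]
  have "((\<lambda>z. (f 0 (u + z) - (\<Sum>i\<le>n. f i u * z ^ i / fact i)) / z ^ n) \<longlongrightarrow> 0) (at 0)" .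
  also have "(\<lambda>z. \<Sum>i\<le>n. f i u * z ^ i / fact i) = (\<lambda>z. \<Sum>i\<le>n. (-1) ^ i * of_nat (Suc i) * eis (i + 2) u * z ^ i)"
    by (intro ext sum.cong refl) (simp add: f_def field_simps del: of_nat_Suc)
  finally show ?thesis by (simp add: f_def numeral_2_eq_2)
qed

lemma eis'_2_expansion:
  "((\<lambda>z. (eis' 2 z - (\<Sum>i\<le>n. (-1) ^ i * of_nat (Suc i) * eis (i + 2) 0 * z ^ i)) / z ^ n)
    \<longlongrightarrow> 0) (at 0)"
proof -
  obtain r where r: "r > 0" "\<And>k z. k \<ge> 2 \<Longrightarrow> z \<in> ball 0 r \<Longrightarrow>
     (eis' k has_field_derivative (- of_nat k * eis' (Suc k) z)) (at z)"
    by (rule eis'_deriv, rule that)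
  define f where "f = (\<lambda>i z. (-1) ^ i * fact (Suc i) * eis' (i + 2) z)"
  have "(f i has_field_derivative f (Suc i) z) (at z)" if "z \<in> ball 0 r" for i z
  proof -
    have "(f i has_field_derivative (-1) ^ i * fact (Suc i) * (- of_nat (i + 2) * eis' (Suc (i + 2)) z)) (at z)"
      unfolding f_def using r that by (intro DERIV_cmult r(2)) auto
    also have "(-1) ^ i * fact (Suc i) * (- of_nat (i + 2) * eis' (Suc (i + 2)) z) = f (Suc i) z"
      by (simp add: f_def algebra_simps)
    finally show ?thesis .
  qed
  from Taylor_little_o[where f = f and r = r and n = n, OF r(1) this]
  have "((\<lambda>z. (f 0 (0 + z) - (\<Sum>i\<le>n. f i 0 * z ^ i / fact i)) / z ^ n) \<longlongrightarrow> 0) (at 0)" .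
  also have "(\<lambda>z. \<Sum>i\<le>n. f i 0 * z ^ i / fact i) = (\<lambda>z. \<Sum>i\<le>n. (-1) ^ i * of_nat (Suc i) * eis (i + 2) 0 * z ^ i)"
    by (intro ext sum.cong refl) (simp add: f_def eis'_0 field_simps del: of_nat_Suc)
  finally show ?thesis by (simp add: f_def numeral_2_eq_2)
qed

lemma eis'_tendsto:
  assumes "k \<ge> 2"
  shows "(eis' k \<longlongrightarrow> eis k 0) (at 0)"
proof -
  obtain r where r: "r > 0" "\<And>k z. k \<ge> 2 \<Longrightarrow> z \<in> ball 0 r \<Longrightarrow>
     (eis' k has_field_derivative (- of_nat k * eis' (Suc k) z)) (at z)"
    by (rule eis'_deriv, rule that)
  have "isCont (eis' k) 0" by (rule DERIV_isCont[OF r(2)]) (use r(1) assms in auto)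
  thus ?thesis using assms by (simp add: isCont_def eis'_0)
qed

lemma eis_holomorphic: "k \<ge> 2 \<Longrightarrow> eis k holomorphic_on - range pt"
  unfolding holomorphic_on_def field_differentiable_def
  by (intro ballI exI, rule has_field_derivative_at_within, rule eis_deriv) auto

text \<open>This is \<open>wp'' = 6 wp^2 - g2 / 2\<close>, because \<open>wp'' = 6 * eis 4\<close>.
  The poles of order 4 cancel, and since \<open>wp = z^(-2) + 3 G z^2 + ...\<close> with
  \<open>G = eis 4 0\<close>, the constant is \<open>G - 6 G\<close>.\<close>

lemma eis_4: 
  assumes "z \<notin> range pt"
  shows "eis 4 z = eis 2 z ^ 2 - 5 * eis 4 0"
proof -
  let ?f = "\<lambda>z. eis 4 z - eis 2 z ^ 2"
  define k where "k = (\<lambda>z. (eis' 2 z - 3 * eis 4 0 * z ^ 2) / z ^ 2)"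
  have "eis 3 0 = 0" by (simp add: eis_odd_0)
  hence k: "(k \<longlongrightarrow> 0) (at 0)"
    using eis'_2_expansion[of 2] eis_2_0 by (simp add: k_def eval_nat_numeral)
  have e: "?f z = eis' 4 z - 2 * (3 * eis 4 0 + k z) - z ^ 4 * (3 * eis 4 0 + k z) ^ 2" if "z \<noteq> 0" for z
  proof -
    have "1 / z ^ 4 + A - (1 / z ^ 2 + z ^ 2 * B) ^ 2 = A - 2 * B - z ^ 4 * B ^ 2" for A B
      using that by (simp add: field_simps eval_nat_numeral)
    moreover have "eis 2 z = 1 / z ^ 2 + z ^ 2 * (3 * eis 4 0 + k z)"
      using that eis_eq_eis'[of 2 z] by (simp add: k_def field_simps)
    ultimately show ?thesis using eis_eq_eis'[of 4 z] by simp
  qed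
  have "((\<lambda>z. eis' 4 z - 2 * (3 * eis 4 0 + k z) - z ^ 4 * (3 * eis 4 0 + k z) ^ 2) \<longlongrightarrow>
       eis 4 0 - 2 * (3 * eis 4 0 + 0) - 0 ^ 4 * (3 * eis 4 0 + 0) ^ 2) (at 0)"
    by (intro tendsto_intros k eis'_tendsto) auto
  moreover have "\<forall>\<^sub>F z in at 0. eis' 4 z - 2 * (3 * eis 4 0 + k z) - z ^ 4 * (3 * eis 4 0 + k z) ^ 2 = ?f z"
    by (simp add: eventually_at_filter e)
  ultimately have "(?f \<longlongrightarrow> eis 4 0 - 2 * (3 * eis 4 0 + 0) - 0 ^ 4 * (3 * eis 4 0 + 0) ^ 2) (at 0)"
    by (rule Lim_transform_eventually)
  hence lim: "(?f \<longlongrightarrow> - 5 * eis 4 0) (at 0)" by simp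
  have "?f z = - 5 * eis 4 0"
  proof (rule elliptic_constant[OF order_refl _ eventually_not_in_range_pt _ _ lim assms])
    show "?f holomorphic_on - range pt" by (intro holomorphic_intros eis_holomorphic) auto
  qed (auto simp: eis_periodic eis_2_periodic simp flip: pt_diff)
  thus ?thesis by (simp add: algebra_simps)
qed

text \<open>With \<open>G = eis 4 0\<close> and \<open>H = eis 6 0\<close>, the cube of
  \<open>wp\<close> begins \<open>z^(-6) + 9 G z^(-2) + 15 H\<close>. Adding \<open>9 G * wp\<close>
  cancels the remaining pole of the difference, and the constant is \<open>H - 15 H\<close>.\<close>

lemma eis_6: 
  assumes "z \<notin> range pt"
  shows "eis 6 z = eis 2 z ^ 3 - 9 * eis 4 0 * eis 2 z - 14 * eis 6 0"
proof -
  let ?f = "\<lambda>z. eis 6 z - eis 2 z ^ 3 + 9 * eis 4 0 * eis 2 z"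
  define k where "k = (\<lambda>z. (eis' 2 z - (3 * eis 4 0 * z ^ 2 + 5 * eis 6 0 * z ^ 4)) / z ^ 4)"
  \<comment> \<open>The quotient of \<open>eis 2 z - 1 / z^2\<close> by \<open>z^2\<close>, so that
    the polar part can be cancelled as an identity before the limit is taken.\<close>
  define q where "q = (\<lambda>z. 3 * eis 4 0 + 5 * eis 6 0 * z ^ 2 + z ^ 2 * k z)"
  have "eis 3 0 = 0" "eis 5 0 = 0" by (simp_all add: eis_odd_0)
  hence k: "(k \<longlongrightarrow> 0) (at 0)"
    using eis'_2_expansion[of 4] eis_2_0 by (simp add: k_def eval_nat_numeral)
  have q: "(q \<longlongrightarrow> 3 * eis 4 0 + 5 * eis 6 0 * 0 ^ 2 + 0 ^ 2 * 0) (at 0)"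
    unfolding q_def by (intro tendsto_intros k)
  let ?g = "\<lambda>z. eis' 6 z - 15 * eis 6 0 - 3 * k z - 3 * z ^ 2 * q z ^ 2 - z ^ 6 * q z ^ 3 + 9 * eis 4 0 * z ^ 2 * q z"
  have e: "?f z = ?g z" if "z \<noteq> 0" for z
  proof -
    have "1 / z ^ 6 + A - (1 / z ^ 2 + z ^ 2 * B) ^ 3 + 9 * G * (1 / z ^ 2 + z ^ 2 * B) =
      A - 15 * H - 3 * ((B - 3 * G - 5 * H * z ^ 2) / z ^ 2) - 3 * z ^ 2 * B ^ 2 - z ^ 6 * B ^ 3 + 9 * G * z ^ 2 * B" for A B G H
      using that by (simp add: field_simps eval_nat_numeral)
    moreover have "eis 2 z = 1 / z ^ 2 + z ^ 2 * q z"
      using that eis_eq_eis'[of 2 z] by (simp add: q_def k_def field_simps)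
    moreover have "k z = (q z - 3 * eis 4 0 - 5 * eis 6 0 * z ^ 2) / z ^ 2"
      using that by (simp add: q_def)
    ultimately show ?thesis using eis_eq_eis'[of 6 z] by simp
  qed
  have "(?g \<longlongrightarrow>
       eis 6 0 - 15 * eis 6 0 - 3 * 0 - 3 * 0 ^ 2 * (3 * eis 4 0 + 5 * eis 6 0 * 0 ^ 2 + 0 ^ 2 * 0) ^ 2
        - 0 ^ 6 * (3 * eis 4 0 + 5 * eis 6 0 * 0 ^ 2 + 0 ^ 2 * 0) ^ 3
        + 9 * eis 4 0 * 0 ^ 2 * (3 * eis 4 0 + 5 * eis 6 0 * 0 ^ 2 + 0 ^ 2 * 0)) (at 0)"
    by (intro tendsto_intros k q eis'_tendsto) auto
  moreover have "\<forall>\<^sub>F z in at 0. ?g z = ?f z"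
    by (simp add: eventually_at_filter e)
  ultimately have lim: "(?f \<longlongrightarrow> - 14 * eis 6 0) (at 0)"
    by (auto dest: Lim_transform_eventually)
  have "?f z = - 14 * eis 6 0"
  proof (rule elliptic_constant[OF order_refl _ eventually_not_in_range_pt _ _ lim assms])
    show "?f holomorphic_on - range pt" by (intro holomorphic_intros eis_holomorphic) auto
  qed (auto simp: eis_periodic eis_2_periodic simp flip: pt_diff)
  thus ?thesis by (simp add: algebra_simps)
qed

lemma eis_5:
  assumes "z \<notin> range pt"
  shows "eis 5 z = eis 2 z * eis 3 z"
proof -
  have "((\<lambda>z. eis 2 z ^ 2 - 5 * eis 4 0) has_field_derivative - of_nat 4 * eis (Suc 4) z) (at z)"
    by (rule has_field_derivative_transform_within_open[OF eis_deriv[of z 4] open_compl_range_pt])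
       (use assms in \<open>auto simp: eis_4\<close>)
  moreover have "((\<lambda>z. eis 2 z ^ 2 - 5 * eis 4 0) has_field_derivative
      of_nat 2 * (- of_nat 2 * eis (Suc 2) z * eis 2 z ^ (2 - Suc 0)) - 0) (at z)"
    using assms by (intro DERIV_diff DERIV_power DERIV_const eis_deriv) auto
  ultimately have "- of_nat 4 * eis (Suc 4) z = of_nat 2 * (- of_nat 2 * eis (Suc 2) z * eis 2 z ^ (2 - Suc 0)) - 0"
    by (rule DERIV_unique)
  thus ?thesis by (simp add: mult_ac)
qed

text \<open>Differentiating \<open>eis_5\<close> and eliminating \<open>eis 6\<close> and
  \<open>eis 4\<close> gives the Weierstrass equation \<open>wp'^2 = 4 wp^3 - g2 wp - g3\<close>,
  where \<open>wp' = - 2 * eis 3\<close>.\<close>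

lemma eis_3_squared:
  assumes "z \<notin> range pt"
  shows "eis 3 z ^ 2 = eis 2 z ^ 3 - 15 * eis 4 0 * eis 2 z - 35 * eis 6 0"
proof -
  have "((\<lambda>z. eis 2 z * eis 3 z) has_field_derivative - of_nat 5 * eis (Suc 5) z) (at z)"
    by (rule has_field_derivative_transform_within_open[OF eis_deriv[of z 5] open_compl_range_pt])
       (use assms in \<open>auto simp: eis_5\<close>)
  moreover have "((\<lambda>z. eis 2 z * eis 3 z) has_field_derivative
      (- of_nat 2 * eis (Suc 2) z) * eis 3 z + (- of_nat 3 * eis (Suc 3) z) * eis 2 z) (at z)"
    using assms by (intro DERIV_mult eis_deriv) auto
  ultimately have "- of_nat 5 * eis (Suc 5) z = (- of_nat 2 * eis (Suc 2) z) * eis 3 z + (- of_nat 3 * eis (Suc 3) z) * eis 2 z"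
    by (rule DERIV_unique)
  hence "5 * eis 6 z = 2 * eis 3 z ^ 2 + 3 * eis 4 z * eis 2 z"
    by (simp add: algebra_simps power2_eq_square)
  thus ?thesis unfolding eis_6[OF assms] eis_4[OF assms] by algebra
qed

section \<open>Points of order three\<close>

lemma eis_2_near_0:
  obtains q where "(q \<longlongrightarrow> 3 * eis 4 0) (at 0)" "\<And>z. z \<noteq> 0 \<Longrightarrow> eis 2 z = (1 + z ^ 4 * q z) / z ^ 2"
proof
  define k where "k = (\<lambda>z. (eis' 2 z - 3 * eis 4 0 * z ^ 2) / z ^ 2)"
  have "eis 3 0 = 0" by (simp add: eis_odd_0)
  hence k: "(k \<longlongrightarrow> 0) (at 0)"
    using eis'_2_expansion[of 2] eis_2_0 by (simp add: k_def eval_nat_numeral)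
  show "((\<lambda>z. 3 * eis 4 0 + k z) \<longlongrightarrow> 3 * eis 4 0) (at 0)"
    using tendsto_add[OF tendsto_const k] by simp
  show "eis 2 z = (1 + z ^ 4 * (3 * eis 4 0 + k z)) / z ^ 2" if "z \<noteq> 0" for z
    using that eis_eq_eis'[of 2 z] by (simp add: k_def field_simps eval_nat_numeral)
qed

lemma eventually_eis_2_neq_at_0: "\<forall>\<^sub>F z in at 0. eis 2 z \<noteq> x"
proof -
  obtain q where q: "(q \<longlongrightarrow> 3 * eis 4 0) (at 0)" "\<And>z. z \<noteq> 0 \<Longrightarrow> eis 2 z = (1 + z ^ 4 * q z) / z ^ 2"
    by (rule eis_2_near_0, rule that)
  have "((\<lambda>z. 1 + z ^ 4 * q z - x * z ^ 2) \<longlongrightarrow> 1 + 0 ^ 4 * (3 * eis 4 0) - x * 0 ^ 2) (at 0)"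
    by (intro tendsto_intros q)
  hence "\<forall>\<^sub>F z in at 0. 1 + z ^ 4 * q z - x * z ^ 2 \<noteq> 0"
    by (rule tendsto_imp_eventually_ne) simp
  moreover have "\<forall>\<^sub>F z in at (0::complex). z \<noteq> 0" by (rule eventually_neq_at_within)
  ultimately show ?thesis
    by eventually_elim (use q(2) in \<open>auto simp: field_simps\<close>)
qed

text \<open>The pole at 0 supplies one point where the value \<open>x\<close> is avoided. As the
  complement of the lattice is connected, the identity theorem isolates the zeros of
  \<open>eis 2 - x\<close>.\<close>

lemma eventually_eis_2_neq:
  assumes "u \<notin> range pt"
  shows "\<forall>\<^sub>F z in at u. eis 2 z \<noteq> x"
proof -
  have "\<forall>\<^sub>F z in at 0. z \<notin> range pt \<and> eis 2 z \<noteq> x"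
    using eventually_not_in_range_pt eventually_eis_2_neq_at_0 by (rule eventually_conj)
  then obtain b where b: "b \<notin> range pt" "eis 2 b \<noteq> x"
    using eventually_happens trivial_limit_at by blast
  have "\<forall>\<^sub>F z in at u. eis 2 z - x \<noteq> 0 \<and> z \<in> - range pt"
    by (rule non_zero_neighbour_alt[OF _ open_compl_range_pt connected_compl_range_pt _ _, of _ u b])
       (use assms b in \<open>auto intro!: holomorphic_intros eis_holomorphic\<close>)
  thus ?thesis by eventually_elim simp
qed

section \<open>The subgroup generated by a point of order 3\<close>

context
  fixes u :: complex
  assumes u: "u \<notin> range pt" "3 * u \<in> range pt"
begin

definition torsion_product :: "complex \<Rightarrow> complex" where
  "torsion_product z = (eis 2 z - eis 2 u) * (eis 2 (u + z) - eis 2 u) * (eis 2 (- u + z) - eis 2 u)"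

text \<open>Since \<open>3 * u\<close> is a lattice point, these three cosets make up the whole
  group generated by the lattice and \<open>u\<close>.\<close>

definition torsion_lattice :: "complex set" where
  "torsion_lattice = {z. z \<in> range pt \<or> u + z \<in> range pt \<or> - u + z \<in> range pt}"

lemma not_in_torsion_lattice:
  assumes "z \<notin> torsion_lattice"
  shows "z \<notin> range pt" "u + z \<notin> range pt" "- u + z \<notin> range pt"
  using assms by (auto simp: torsion_lattice_def)

lemma torsion_lattice_cases:
  assumes "p \<in> torsion_lattice"
  obtains a where "p = pt a" | a where "p = pt a - u" | a where "p = pt a + u"
proof -
  consider "p \<in> range pt" | "u + p \<in> range pt" | "- u + p \<in> range pt"
    using assms by (auto simp: torsion_lattice_def)
  thus ?thesis
  proof cases
    case 1
    thus ?thesis using that(1) by auto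
  next
    case 2
    then obtain a where "u + p = pt a" by auto
    hence "p = pt a - u" by (simp add: algebra_simps)
    thus ?thesis by (rule that(2))
  next
    case 3
    then obtain a where "- u + p = pt a" by auto
    hence "p = pt a + u" by (simp add: algebra_simps)
    thus ?thesis by (rule that(3))
  qed
qed

lemma torsion_lattice_diff:
  assumes "p \<in> torsion_lattice" "q \<in> torsion_lattice"
  shows "p - q \<in> torsion_lattice"
proof -
  obtain v where v: "3 * u = pt v" using u(2) by auto
  have shape: "\<exists>a e. p = pt a + of_int e * u \<and> (e = 0 \<or> e = 1 \<or> e = -1)" if "p \<in> torsion_lattice" for p
    using that
  proof (cases rule: torsion_lattice_cases)
    case (1 a)
    thus ?thesis by (intro exI[of _ a] exI[of _ 0]) simp
  next
    case (2 a)
    thus ?thesis by (intro exI[of _ a] exI[of _ "-1"]) simp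
  next
    case (3 a)
    thus ?thesis by (intro exI[of _ a] exI[of _ 1]) simp
  qed
  obtain a e where p: "p = pt a + of_int e * u" "e = 0 \<or> e = 1 \<or> e = -1" using shape[OF assms(1)] by metis
  obtain b e' where q: "q = pt b + of_int e' * u" "e' = 0 \<or> e' = 1 \<or> e' = -1" using shape[OF assms(2)] by metis
  have d: "p - q = pt (a - b) + of_int (e - e') * u" by (simp add: p q pt_diff algebra_simps)
  consider "e - e' = 0" | "e - e' = 1" | "e - e' = -1" | "e - e' = 2" | "e - e' = -2"
    using p(2) q(2) by force
  thus ?thesis
  proof cases
    case 1
    hence "p - q = pt (a - b)" using d by simp
    thus ?thesis by (simp add: torsion_lattice_def)
  next
    case 2
    hence "- u + (p - q) = pt (a - b)" unfolding d by simp
    thus ?thesis by (simp add: torsion_lattice_def)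
  next
    case 3
    hence "u + (p - q) = pt (a - b)" unfolding d by simp
    thus ?thesis by (simp add: torsion_lattice_def)
  next
    \<comment> \<open>Here \<open>2 u\<close> is congruent to \<open>- u\<close>, through
      \<open>3 u = pt v\<close>; the next case is its mirror image.\<close>
    case 4
    hence "u + (p - q) = pt (a - b + v)" unfolding d pt_add v[symmetric] by simp
    thus ?thesis by (simp add: torsion_lattice_def)
  next
    case 5
    hence "- u + (p - q) = pt (a - b - v)" unfolding d pt_diff[of _ v] v[symmetric] by simp
    thus ?thesis by (simp add: torsion_lattice_def)
  qed
qed

lemma eventually_not_in_torsion_lattice: "\<forall>\<^sub>F z in at w. z \<notin> torsion_lattice"
proof -
  have shift: "\<forall>\<^sub>F z in at w. c + z \<notin> range pt" for c
    using eventually_not_in_range_pt[of "c + w"]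
    by (subst (asm) at_to_0, subst at_to_0) (simp add: eventually_filtermap add_ac)
  have "\<forall>\<^sub>F z in at w. 0 + z \<notin> range pt \<and> u + z \<notin> range pt \<and> - u + z \<notin> range pt"
    by (intro eventually_conj shift)
  thus ?thesis by eventually_elim (simp add: torsion_lattice_def)
qed

lemma torsion_product_periodic:
  assumes z: "z \<notin> torsion_lattice" and p: "p \<in> torsion_lattice"
  shows "torsion_product (z + p) = torsion_product z"
proof -
  obtain v where v: "3 * u = pt v" using u(2) by auto
  have D0: "0 \<in> torsion_lattice"
    using range_pt_add_iff pt_0 by (metis (mono_tags, lifting) mem_Collect_eq rangeI torsion_lattice_def)
  have uD: "u \<in> torsion_lattice" unfolding torsion_lattice_def using pt_0
    by (metis (mono_tags, lifting) add.left_inverse mem_Collect_eq rangeI)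
  have closed: "z - p \<notin> torsion_lattice" if "z \<notin> torsion_lattice" "p \<in> torsion_lattice" for z p
    using torsion_lattice_diff[OF that(2) torsion_lattice_diff[OF D0 torsion_lattice_diff[OF _ that(2)]], of z]
      torsion_lattice_diff[of "z - p" "0 - p"] torsion_lattice_diff[OF D0 that(2)] that by auto
  have per_pt: "torsion_product (z + pt a) = torsion_product z" if "z \<notin> torsion_lattice" for z a
    using not_in_torsion_lattice[OF that]
    by (simp only: torsion_product_def eis_2_periodic not_False_eq_True flip: add.assoc)
  \<comment> \<open>Translation by \<open>u\<close> permutes the three factors cyclically, because
    \<open>2 u\<close> and \<open>- u\<close> differ by a lattice point.\<close>
  have per_u: "torsion_product (z + u) = torsion_product z" if "z \<notin> torsion_lattice" for z
  proof -
    have eq: "u + (z + u) = - u + z + pt v" by (simp flip: v)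
    have "eis 2 (u + (z + u)) = eis 2 (- u + z)"
      unfolding eq by (rule eis_2_periodic[OF not_in_torsion_lattice(3)[OF that]])
    thus ?thesis by (simp add: torsion_product_def add_ac mult_ac)
  qed
  from p show ?thesis
  proof (cases rule: torsion_lattice_cases)
    case (1 a)
    thus ?thesis using per_pt z by simp
  next
    case (2 a)
    have "torsion_product (z - u) = torsion_product z"
      using per_u[OF closed[OF z uD]] by simp
    moreover have "torsion_product (z - u + pt a) = torsion_product (z - u)"
      by (rule per_pt[OF closed[OF z uD]])
    moreover have "z + p = z - u + pt a" using 2 by simp
    ultimately show ?thesis by metis
  next
    case (3 a)
    have "z - (0 - u) \<notin> torsion_lattice" by (rule closed[OF z torsion_lattice_diff[OF D0 uD]])
    hence "torsion_product (z + u + pt a) = torsion_product (z + u)" using per_pt by simp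
    moreover have "z + p = z + u + pt a" using 3 by simp
    ultimately show ?thesis using per_u[OF z] by metis
  qed
qed

text \<open>The three double poles of \<open>torsion_product\<close> cancel against zeros, so it is constant. The
  constant term and the quadratic term of its expansion at 0 yield the constant and the 3-division
  polynomial.\<close>
lemma torsion_product_eq: "z \<notin> torsion_lattice \<Longrightarrow> torsion_product z = - 4 * eis 3 u ^ 2"
  and three_division: "9 * eis 4 u ^ 2 = 12 * eis 2 u * eis 3 u ^ 2"
proof -
  define x y E F where "x = eis 2 u" and "y = eis 3 u" and "E = eis 4 u" and "F = eis 5 u"
  have mu: "- u \<notin> range pt" using u(1) range_pt_minus_iff by blast
  obtain q where q: "(q \<longlongrightarrow> 3 * eis 4 0) (at 0)" "\<And>z. z \<noteq> 0 \<Longrightarrow> eis 2 z = (1 + z ^ 4 * q z) / z ^ 2"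
    by (rule eis_2_near_0, rule that)
  \<comment> \<open>\<open>k1\<close> and \<open>k2\<close> are the third-order Taylor remainders at
    \<open>u\<close> and \<open>- u\<close>. The odd coefficients change sign between the two points
    because \<open>eis 2\<close> is even.\<close>
  define k1 where "k1 = (\<lambda>z. (eis 2 (u + z) - (x - 2 * y * z + 3 * E * z ^ 2 - 4 * F * z ^ 3)) / z ^ 3)"
  define k2 where "k2 = (\<lambda>z. (eis 2 (- u + z) - (x + 2 * y * z + 3 * E * z ^ 2 + 4 * F * z ^ 3)) / z ^ 3)"
  have sum3: "(\<Sum>i\<le>3. g i) = g 0 + g 1 + g 2 + g 3" for g :: "nat \<Rightarrow> complex"
    by (simp add: eval_nat_numeral)
  have idx: "eis (Suc (Suc 0)) = eis 2" "eis (Suc (Suc (Suc 0))) = eis 3"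
    by (simp_all add: eval_nat_numeral)
  have k1: "(k1 \<longlongrightarrow> 0) (at 0)"
    using eis_2_expansion[OF u(1), of 3] unfolding sum3 k1_def x_def y_def E_def F_def by (simp add: idx)
  have k2: "(k2 \<longlongrightarrow> 0) (at 0)"
    using eis_2_expansion[OF mu, of 3] unfolding sum3 k2_def x_def y_def E_def F_def
    by (simp add: idx eis_minus)
  \<comment> \<open>\<open>a\<close> and \<open>b\<close> are the last two factors of the product
    divided by \<open>z\<close>. Their two simple zeros at 0 cancel the double pole of the first
    factor.\<close>
  define a where "a = (\<lambda>z. - 2 * y + 3 * E * z - 4 * F * z ^ 2 + z ^ 2 * k1 z)"
  define b where "b = (\<lambda>z. 2 * y + 3 * E * z + 4 * F * z ^ 2 + z ^ 2 * k2 z)"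
  have a_lim: "(a \<longlongrightarrow> - 2 * y + 3 * E * 0 - 4 * F * 0 ^ 2 + 0 ^ 2 * 0) (at 0)"
    unfolding a_def by (intro tendsto_intros k1)
  have b_lim: "(b \<longlongrightarrow> 2 * y + 3 * E * 0 + 4 * F * 0 ^ 2 + 0 ^ 2 * 0) (at 0)"
    unfolding b_def by (intro tendsto_intros k2)
  have a: "eis 2 (u + z) - x = z * a z" if "z \<noteq> 0" for z
    using that by (simp add: a_def k1_def field_simps eval_nat_numeral)
  have b: "eis 2 (- u + z) - x = z * b z" if "z \<noteq> 0" for z
    using that by (simp add: b_def k2_def field_simps eval_nat_numeral)
  have prod: "(1 + z ^ 4 * q z - x * z ^ 2) * (a z * b z) = torsion_product z" if "z \<noteq> 0" for z
  proof -
    have "eis 2 z - x = (1 + z ^ 4 * q z - x * z ^ 2) / z ^ 2"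
      using that q(2) by (simp add: field_simps)
    thus ?thesis using that a[OF that] b[OF that]
      by (simp add: torsion_product_def power2_eq_square flip: x_def)
  qed
  have "((\<lambda>z. (1 + z ^ 4 * q z - x * z ^ 2) * (a z * b z)) \<longlongrightarrow>
      (1 + 0 ^ 4 * (3 * eis 4 0) - x * 0 ^ 2) * ((- 2 * y + 3 * E * 0 - 4 * F * 0 ^ 2 + 0 ^ 2 * 0) *
       (2 * y + 3 * E * 0 + 4 * F * 0 ^ 2 + 0 ^ 2 * 0))) (at 0)"
    by (intro tendsto_intros a_lim b_lim q(1))
  moreover have "\<forall>\<^sub>F z in at 0. (1 + z ^ 4 * q z - x * z ^ 2) * (a z * b z) = torsion_product z"
    by (simp add: eventually_at_filter prod)
  ultimately have lim: "(torsion_product \<longlongrightarrow> - 4 * y ^ 2) (at 0)"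
    by (auto dest: Lim_transform_eventually simp: power2_eq_square)
  have const: "torsion_product z = - 4 * y ^ 2" if "z \<notin> torsion_lattice" for z
  proof (rule elliptic_constant[OF _ torsion_lattice_diff eventually_not_in_torsion_lattice _
        torsion_product_periodic lim that])
    show "range pt \<subseteq> torsion_lattice" by (auto simp: torsion_lattice_def)
    have comp: "(\<lambda>z. eis 2 (c + z)) holomorphic_on A" if "\<And>z. z \<in> A \<Longrightarrow> c + z \<notin> range pt" for c A
      using that by (intro holomorphic_on_compose_gen[of "\<lambda>z. c + z" A "eis 2" "- range pt", unfolded o_def])
        (auto intro!: holomorphic_intros eis_holomorphic)
    have "(\<lambda>z. eis 2 (0 + z)) holomorphic_on - torsion_lattice"
      "(\<lambda>z. eis 2 (u + z)) holomorphic_on - torsion_lattice"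
      "(\<lambda>z. eis 2 (- u + z)) holomorphic_on - torsion_lattice"
      by (rule comp; use not_in_torsion_lattice in force)+
    thus "torsion_product holomorphic_on - torsion_lattice"
      unfolding torsion_product_def[abs_def] by (intro holomorphic_intros) auto
  qed
  thus "z \<notin> torsion_lattice \<Longrightarrow> torsion_product z = - 4 * eis 3 u ^ 2" by (simp add: y_def)
  \<comment> \<open>The product minus its constant value, divided by \<open>z^2\<close> and written
    without denominators. It vanishes near 0 away from 0, so its limit, the quadratic coefficient,
    is 0.\<close>
  let ?g = "\<lambda>z. 9 * E ^ 2 - 16 * y * F + 2 * y * (k1 z - k2 z) + 3 * E * z * (k1 z + k2 z)
       + z ^ 2 * (k1 z - 4 * F) * (k2 z + 4 * F) + (z ^ 2 * q z - x) * (a z * b z)"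
  have "?g z = 0" if "z \<noteq> 0" "z \<notin> torsion_lattice" for z
  proof -
    have "z ^ 2 * ?g z = (1 + z ^ 4 * q z - x * z ^ 2) * (a z * b z) + 4 * y ^ 2"
      unfolding a_def b_def by algebra
    also have "\<dots> = 0" using prod[OF that(1)] const[OF that(2)] by simp
    finally show ?thesis using that by simp
  qed
  moreover have "\<forall>\<^sub>F z in at (0::complex). z \<noteq> 0" by (rule eventually_neq_at_within)
  ultimately have "\<forall>\<^sub>F z in at 0. ?g z = 0"
    using eventually_not_in_torsion_lattice[of 0] by (auto elim: eventually_elim2)
  hence g0: "(?g \<longlongrightarrow> 0) (at 0)" by (rule tendsto_eventually)
  have g1: "(?g \<longlongrightarrow> 9 * E ^ 2 - 16 * y * F + 2 * y * (0 - 0) + 3 * E * 0 * (0 + 0)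
       + 0 ^ 2 * (0 - 4 * F) * (0 + 4 * F) + (0 ^ 2 * (3 * eis 4 0) - x) * ((- 2 * y + 3 * E * 0 - 4 * F * 0 ^ 2 + 0 ^ 2 * 0) *
       (2 * y + 3 * E * 0 + 4 * F * 0 ^ 2 + 0 ^ 2 * 0))) (at 0)"
    by (intro tendsto_intros a_lim b_lim q(1) k1 k2)
  have "9 * E ^ 2 - 16 * y * F + 4 * x * y ^ 2 = 0"
    using LIM_unique[OF g0 g1] by (simp add: power2_eq_square algebra_simps)
  moreover have "F = x * y" using eis_5[OF u(1)] by (simp add: F_def x_def y_def)
  ultimately show "9 * eis 4 u ^ 2 = 12 * eis 2 u * eis 3 u ^ 2"
    unfolding x_def y_def E_def by algebra
qed

text \<open>Otherwise the product would vanish identically off the extended lattice, although each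
  of its three factors is nonzero near 0 away from 0.\<close>

lemma eis_3_nonzero: "eis 3 u \<noteq> 0"
proof
  assume 0: "eis 3 u = 0"
  have shift: "\<forall>\<^sub>F z in at 0. eis 2 (c + z) \<noteq> eis 2 u" if "c \<notin> range pt" for c
    using eventually_eis_2_neq[OF that, of "eis 2 u"]
    by (subst (asm) at_to_0) (simp add: eventually_filtermap add_ac)
  have mu: "- u \<notin> range pt" using u(1) range_pt_minus_iff by blast
  have "\<forall>\<^sub>F z in at 0. eis 2 z \<noteq> eis 2 u \<and> eis 2 (u + z) \<noteq> eis 2 u \<and> eis 2 (- u + z) \<noteq> eis 2 u
     \<and> z \<notin> torsion_lattice"
    by (intro eventually_conj eventually_eis_2_neq_at_0 shift u mu eventually_not_in_torsion_lattice)
  then obtain z where "eis 2 z \<noteq> eis 2 u" "eis 2 (u + z) \<noteq> eis 2 u" "eis 2 (- u + z) \<noteq> eis 2 u"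
     "z \<notin> torsion_lattice"
    using eventually_happens trivial_limit_at by blast
  moreover from this have "torsion_product z = 0" using torsion_product_eq 0 by simp
  ultimately show False by (simp add: torsion_product_def)
qed

text \<open>Anywhere else the first factor at \<open>v\<close> would be zero, against the nonzero
  constant value of the product. Hence different subgroups of order 3 have different
  abscissas.\<close>

lemma eis_2_eq_imp:
  assumes "eis 2 v = eis 2 u"
  shows "v \<in> range pt \<or> u + v \<in> range pt \<or> - u + v \<in> range pt"
proof (rule ccontr)
  assume "\<not> ?thesis"
  hence "torsion_product v = - 4 * eis 3 u ^ 2"
    by (intro torsion_product_eq) (simp add: torsion_lattice_def)
  thus False using assms eis_3_nonzero by (simp add: torsion_product_def)
qed

lemma psi3_eis_2: "psi3 (60 * eis 4 0) (140 * eis 6 0) (eis 2 u) = 0"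
  using three_division unfolding eis_4[OF u(1)] eis_3_squared[OF u(1)] psi3_def by algebra

end

section \<open>Lattices of index 3 and their invariants\<close>

definition third :: "int \<Rightarrow> int \<Rightarrow> complex" where
  "third p q = pt (p, q) / 3"

lemma third_in_range_iff: "third p q \<in> range pt \<longleftrightarrow> 3 dvd p \<and> 3 dvd q"
proof
  assume "third p q \<in> range pt"
  then obtain a where "pt (p, q) = 3 * pt a" by (auto simp: third_def field_simps)
  also have "3 * pt a = pt (3 * fst a, 3 * snd a)" by (simp add: pt_def algebra_simps)
  finally show "3 dvd p \<and> 3 dvd q" by (simp add: pt_eq_iff)
next
  assume "3 dvd p \<and> 3 dvd q"
  then obtain x y where "p = 3 * x" "q = 3 * y" by (auto elim!: dvdE)
  hence "third p q = pt (x, y)" by (simp add: third_def pt_def field_simps)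
  thus "third p q \<in> range pt" by simp
qed

lemma third_add: "third p q + third p' q' = third (p + p') (q + q')"
  and third_minus: "- third p q = third (- p) (- q)"
  by (simp_all add: third_def pt_def field_simps)

lemma three_third: "3 * third p q = pt (p, q)"
  by (simp add: third_def)

lemma eisenstein_G_eq_infsum:
  assumes "k \<ge> 3"
  shows "eisenstein_G k z = (\<Sum>\<^sub>\<infinity>a::int \<times> int. 1 / (of_int (fst a) * z + of_int (snd a)) ^ k)"
  unfolding eisenstein_G_def
  by (rule infsum_cong_neutral) (use assms in \<open>auto simp: power_0_left\<close>)

lemma eisenstein_G_tau:
  assumes "k \<ge> 3"
  shows "eisenstein_G k \<tau> = eis k 0"
  using assms by (simp add: eisenstein_G_eq_infsum eis_def eis_term_def pt_def)

text \<open>A lattice point with coordinates congruent to \<open>(p, q)\<close> modulo 3 is three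
  times a translate of \<open>third p q\<close>; homogeneity of degree \<open>- k\<close> gives the
  factor.\<close>

lemma infsum_third_coset:
  assumes "k \<ge> 3"
  shows "(\<Sum>\<^sub>\<infinity>a\<in>range (\<lambda>a. (3 * fst a + p, 3 * snd a + q)). eis_term k 0 a) = eis k (third p q) / 3 ^ k"
proof -
  have "(\<Sum>\<^sub>\<infinity>a\<in>range (\<lambda>a. (3 * fst a + p, 3 * snd a + q)). eis_term k 0 a)
      = (\<Sum>\<^sub>\<infinity>a. eis_term k 0 (3 * fst a + p, 3 * snd a + q))"
    by (subst infsum_reindex) (auto simp: inj_on_def o_def)
  also have "(\<lambda>a. eis_term k 0 (3 * fst a + p, 3 * snd a + q)) = (\<lambda>a. inverse (3 ^ k) * eis_term k (third p q) a)"
  proof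
    fix a
    have "pt (3 * fst a + p, 3 * snd a + q) = 3 * (third p q + pt a)"
      by (simp add: third_def pt_def field_simps)
    hence "0 + pt (3 * fst a + p, 3 * snd a + q) = 3 * (third p q + pt a)" by simp
    thus "eis_term k 0 (3 * fst a + p, 3 * snd a + q) = inverse (3 ^ k) * eis_term k (third p q) a"
      using assms by (simp only: eis_term_def power_mult_distrib) (simp add: field_simps)
  qed
  also have "(\<Sum>\<^sub>\<infinity>a. inverse (3 ^ k) * eis_term k (third p q) a) = eis k (third p q) / 3 ^ k"
    by (simp only: infsum_cmult_right' eis_def divide_inverse mult.commute)
  finally show ?thesis .
qed

text \<open>The lattice spanned by \<open>a \<tau> + b\<close> and \<open>c \<tau> + d\<close> is, up to the factor 3, the lattice of
  \<open>\<tau>\<close> extended by the 3-torsion point \<open>third p q\<close>.\<close>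
lemma eisenstein_G_sublattice:
  fixes a b c d p q :: int
  assumes k: "k \<ge> 3"
    and span: "\<And>m n. (\<exists>x y. m = x * a + y * c \<and> n = x * b + y * d) \<longleftrightarrow>
      (\<exists>x y. (m = 3 * x \<and> n = 3 * y) \<or> (m = 3 * x + p \<and> n = 3 * y + q) \<or> (m = 3 * x - p \<and> n = 3 * y - q))"
    and det: "a * d - b * c \<noteq> 0"
    and nd: "\<not> (3 dvd p \<and> 3 dvd q)"
  shows "eisenstein_G k ((of_int a * \<tau> + of_int b) / (of_int c * \<tau> + of_int d)) =
    ((of_int c * \<tau> + of_int d) / 3) ^ k * (eis k 0 + eis k (third p q) + eis k (- third p q))"
proof -
  define \<beta> where "\<beta> = of_int c * \<tau> + of_int d"
  \<comment> \<open>\<open>\<phi>\<close> converts coordinates in the basis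
    \<open>a \<tau> + b\<close>, \<open>c \<tau> + d\<close> to the basis \<open>\<tau>\<close>, 1.
    The sets \<open>R\<close> below are cosets modulo 3, and \<open>span\<close> says that three of
    them fill the range of \<open>\<phi>\<close>.\<close>
  define \<phi> where "\<phi> = (\<lambda>x::int \<times> int. (fst x * a + snd x * c, fst x * b + snd x * d))"
  define R where "R = (\<lambda>p q. range (\<lambda>x::int \<times> int. (3 * fst x + p, 3 * snd x + q)))"
  have "(c, d) \<noteq> 0" using det by (auto simp: zero_prod_def)
  hence \<beta>: "\<beta> \<noteq> 0" using pt_eq_0_iff[of "(c, d)"] by (simp add: \<beta>_def pt_def)
  have inj: "inj \<phi>"
  proof (rule injI)
    fix x y assume "\<phi> x = \<phi> y"
    hence e: "fst x * a + snd x * c = fst y * a + snd y * c" "fst x * b + snd x * d = fst y * b + snd y * d"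
      by (simp_all add: \<phi>_def)
    have "(fst x - fst y) * (a * d - b * c) = 0" "(snd x - snd y) * (a * d - b * c) = 0"
      using e by algebra+
    thus "x = y" using det by (simp add: prod_eq_iff)
  qed
  have "range \<phi> = R 0 0 \<union> R p q \<union> R (- p) (- q)"
  proof (intro set_eqI)
    fix w :: "int \<times> int"
    obtain m n where w: "w = (m, n)" by (cases w)
    have "w \<in> range \<phi> \<longleftrightarrow> (\<exists>x y. m = x * a + y * c \<and> n = x * b + y * d)"
      by (auto simp: w \<phi>_def image_iff)
    moreover have "w \<in> R 0 0 \<union> R p q \<union> R (- p) (- q) \<longleftrightarrow> 
      (\<exists>x y. (m = 3 * x \<and> n = 3 * y) \<or> (m = 3 * x + p \<and> n = 3 * y + q) \<or> (m = 3 * x - p \<and> n = 3 * y - q))"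
      by (auto simp: w R_def image_iff)
    ultimately show "w \<in> range \<phi> \<longleftrightarrow> w \<in> R 0 0 \<union> R p q \<union> R (- p) (- q)"
      using span by simp
  qed
  moreover have disj: "R 0 0 \<inter> R p q = {}" "(R 0 0 \<union> R p q) \<inter> R (- p) (- q) = {}"
  proof -
    have "False" if "3 * x + p = 3 * x'" "3 * y + q = 3 * y'" for x x' y y'
      using nd that by presburger
    moreover have "False" if "3 * x - p = 3 * x'" "3 * y - q = 3 * y'" for x x' y y'
      using nd that by presburger
    moreover have "False" if "3 * x - p = 3 * x' + p" "3 * y - q = 3 * y' + q" for x x' y y'
      using nd that by presburger
    ultimately show "R 0 0 \<inter> R p q = {}" "(R 0 0 \<union> R p q) \<inter> R (- p) (- q) = {}"
      by (auto simp: R_def) (metis+)?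
  qed
  ultimately have sum: "(\<Sum>\<^sub>\<infinity>w\<in>range \<phi>. eis_term k 0 w) =
    (\<Sum>\<^sub>\<infinity>w\<in>R 0 0. eis_term k 0 w) + (\<Sum>\<^sub>\<infinity>w\<in>R p q. eis_term k 0 w) + (\<Sum>\<^sub>\<infinity>w\<in>R (- p) (- q). eis_term k 0 w)"
    using k by (simp add: infsum_Un_disjoint summable_on_Un_disjoint eis_term_summable)
  have "1 / (of_int (fst x) * ((of_int a * \<tau> + of_int b) / \<beta>) + of_int (snd x)) ^ k = \<beta> ^ k * eis_term k 0 (\<phi> x)" for x
  proof -
    have "of_int (fst x) * ((of_int a * \<tau> + of_int b) / \<beta>) + of_int (snd x) = pt (\<phi> x) / \<beta>"
      using \<beta> by (simp add: field_simps) (simp add: \<beta>_def \<phi>_def pt_def algebra_simps)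
    thus ?thesis using k by (simp add: eis_term_def power_divide)
  qed
  hence "eisenstein_G k ((of_int a * \<tau> + of_int b) / \<beta>) = \<beta> ^ k * (\<Sum>\<^sub>\<infinity>x. eis_term k 0 (\<phi> x))"
    using k by (simp add: eisenstein_G_eq_infsum infsum_cmult_right')
  also have "(\<Sum>\<^sub>\<infinity>x. eis_term k 0 (\<phi> x)) = (\<Sum>\<^sub>\<infinity>w\<in>range \<phi>. eis_term k 0 w)"
    by (subst infsum_reindex[OF inj]) (simp add: o_def)
  also have "\<dots> = (eis k 0 + eis k (third p q) + eis k (- third p q)) / 3 ^ k"
    unfolding sum R_def infsum_third_coset[OF k]
    by (simp add: third_minus add_divide_distrib) (simp add: third_def pt_def)
  finally show ?thesis by (simp add: \<beta>_def power_divide)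
qed

text \<open>The three coset sums turn into polynomials in \<open>x\<close> by \<open>eis_4\<close>
  and \<open>eis_6\<close>, the cosets of \<open>third p q\<close> and its negative contributing
  equally for even \<open>k\<close>. The common scale \<open>(\<beta> / 3)^2\<close> does not affect
  j.\<close>

lemma modular_j_sublattice:
  fixes a b c d p q :: int
  defines "x \<equiv> eis 2 (third p q)" and "g2 \<equiv> 60 * eis 4 0" and "g3 \<equiv> 140 * eis 6 0"
  assumes span: "\<And>m n. (\<exists>x y. m = x * a + y * c \<and> n = x * b + y * d) \<longleftrightarrow>
      (\<exists>x y. (m = 3 * x \<and> n = 3 * y) \<or> (m = 3 * x + p \<and> n = 3 * y + q) \<or> (m = 3 * x - p \<and> n = 3 * y - q))"
    and det: "a * d - b * c \<noteq> 0"
    and nd: "\<not> (3 dvd p \<and> 3 dvd q)"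
  shows "modular_j ((of_int a * \<tau> + of_int b) / (of_int c * \<tau> + of_int d)) =
    j_of (120 * x ^ 2 - 9 * g2) (280 * x ^ 3 - 42 * g2 * x - 27 * g3)"
proof -
  define \<beta> where "\<beta> = of_int c * \<tau> + of_int d"
  define \<sigma> where "\<sigma> = (of_int a * \<tau> + of_int b) / \<beta>"
  have "(c, d) \<noteq> 0" using det by (auto simp: zero_prod_def)
  hence \<beta>: "\<beta> \<noteq> 0" using pt_eq_0_iff[of "(c, d)"] by (simp add: \<beta>_def pt_def)
  have t: "third p q \<notin> range pt" using nd third_in_range_iff by simp
  have G: "eisenstein_G k \<sigma> = (\<beta> / 3) ^ k * (eis k 0 + eis k (third p q) + eis k (- third p q))" if "k \<ge> 3" for k
    unfolding \<sigma>_def \<beta>_def by (rule eisenstein_G_sublattice[OF that span det nd])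
  have "weierstrass_g2 \<sigma> = ((\<beta> / 3) ^ 2) ^ 2 * (120 * x ^ 2 - 9 * g2)"
    by (simp add: weierstrass_g2_def G eis_minus eis_4[OF t] g2_def flip: x_def power_mult)
  moreover have "weierstrass_g3 \<sigma> = ((\<beta> / 3) ^ 2) ^ 3 * (280 * x ^ 3 - 42 * g2 * x - 27 * g3)"
    by (simp add: weierstrass_g3_def G eis_minus eis_6[OF t] g2_def g3_def flip: x_def power_mult)
  moreover have "modular_j \<sigma> = j_of (weierstrass_g2 \<sigma>) (weierstrass_g3 \<sigma>)"
    by (simp add: modular_j_def j_of_def)
  moreover have "(\<beta> / 3) ^ 2 \<noteq> 0" using \<beta> by simp
  ultimately show ?thesis unfolding \<sigma>_def \<beta>_def[symmetric] using j_of_scale by metis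
qed

end

section \<open>Matching the modular equation with the four lattices\<close>

theorem theorem4:
  fixes \<tau> l l' :: complex
  assumes "\<tau> \<in> upper_half_plane"
    and "l \<in> UNIV - {0, 1}"
    and "modular_j \<tau> = 256 * ((l^2 - l + 1)^3 / (l^2 - l)^2)"
    and "l' \<in> UNIV - {0, 1}"
    and "\<exists>s. s^2 = l * l' \<and> (l + l' + 6 * s)^2 = 16 * (1 + s)^2 * s"
  shows "256 * ((l'^2 - l' + 1)^3 / (l'^2 - l')^2) \<in>
    {modular_j (3 * \<tau>), modular_j (\<tau> / 3),
     modular_j ((\<tau> + 2) / (- \<tau> + 1)), modular_j ((\<tau> - 2) / (\<tau> + 1))}"
proof -
  interpret complex_lattice \<tau>
    using assms(1) by unfold_locales (simp add: upper_half_plane_def)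
  define g2 g3 where "g2 = 60 * eis 4 0" and "g3 = 140 * eis 6 0"
  define X where "X = (\<lambda>p q. eis 2 (third p q))"
  define J where "J = (\<lambda>x. j_of (120 * x ^ 2 - 9 * g2) (280 * x ^ 3 - 42 * g2 * x - 27 * g3))"
  \<comment> \<open>Each argument is written as \<open>(a \<tau> + b) / (c \<tau> + d)\<close> with
    determinant 3. The four vectors \<open>(p, q)\<close> represent the four lines in the plane over
    the field with three elements.\<close>
  have J: "modular_j (3 * \<tau>) = J (X 0 1)" "modular_j (\<tau> / 3) = J (X 1 0)"
    "modular_j ((\<tau> + 2) / (- \<tau> + 1)) = J (X 1 (-1))" "modular_j ((\<tau> - 2) / (\<tau> + 1)) = J (X 1 1)"
  proof -
    have "modular_j ((of_int 3 * \<tau> + of_int 0) / (of_int 0 * \<tau> + of_int 1)) = J (X 0 1)"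
      unfolding J_def X_def g2_def g3_def by (rule modular_j_sublattice) presburger+
    thus "modular_j (3 * \<tau>) = J (X 0 1)" by simp
    have "modular_j ((of_int 1 * \<tau> + of_int 0) / (of_int 0 * \<tau> + of_int 3)) = J (X 1 0)"
      unfolding J_def X_def g2_def g3_def by (rule modular_j_sublattice) presburger+
    thus "modular_j (\<tau> / 3) = J (X 1 0)" by simp
    have "modular_j ((of_int 1 * \<tau> + of_int 2) / (of_int (-1) * \<tau> + of_int 1)) = J (X 1 (-1))"
      unfolding J_def X_def g2_def g3_def by (rule modular_j_sublattice) presburger+
    thus "modular_j ((\<tau> + 2) / (- \<tau> + 1)) = J (X 1 (-1))" by simp
    have "modular_j ((of_int 1 * \<tau> + of_int (-2)) / (of_int 1 * \<tau> + of_int 1)) = J (X 1 1)"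
      unfolding J_def X_def g2_def g3_def by (rule modular_j_sublattice) presburger+
    thus "modular_j ((\<tau> - 2) / (\<tau> + 1)) = J (X 1 1)" by simp
  qed
  \<comment> \<open>Neither the sum nor the difference of the two points is a lattice point, so
    \<open>eis_2_eq_imp\<close> keeps their abscissas apart.\<close>
  have X_neq: "X p q \<noteq> X p' q'"
    if "\<not> (3 dvd p \<and> 3 dvd q)" "\<not> (3 dvd p' \<and> 3 dvd q')"
      "\<not> (3 dvd p + p' \<and> 3 dvd q + q')" "\<not> (3 dvd p' - p \<and> 3 dvd q' - q)" for p q p' q'
    using eis_2_eq_imp[of "third p q" "third p' q'"] that
    by (auto simp: X_def third_minus third_add third_in_range_iff three_third)
  let ?roots = "[X 0 1, X 1 0, X 1 (-1), X 1 1]"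
  have distinct: "distinct ?roots" by (simp add: X_neq)
  have psi3_X: "psi3 g2 g3 (X p q) = 0" if "\<not> (3 dvd p \<and> 3 dvd q)" for p q
    using psi3_eis_2[of "third p q"] that
    by (simp add: X_def g2_def g3_def third_in_range_iff three_third)
  have roots: "psi3 g2 g3 r = 0" if "r \<in> set ?roots" for r
    using that by (auto simp: psi3_X)
  have \<Delta>: "g2 ^ 3 - 27 * g3 ^ 2 \<noteq> 0"
  proof
    assume "g2 ^ 3 - 27 * g3 ^ 2 = 0"
    then obtain e where e: "\<And>x. psi3 g2 g3 x = 48 * ((x - e) ^ 3 * (x + 3 * e))"
      using discriminant_zero_psi3 by blast
    have "set ?roots \<subseteq> {e, - 3 * e}" using roots unfolding e by (auto simp: add_eq_0_iff2)
    hence "card (set ?roots) \<le> card {e, - 3 * e}" by (intro card_mono) auto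
    moreover have "card {e, - 3 * e} \<le> 2" by (simp add: card_insert_if)
    moreover have "card (set ?roots) = 4" using distinct_card[OF distinct] by simp
    ultimately show False by linarith
  qed
  have l: "l \<noteq> 0" "l \<noteq> 1" and l': "l' \<noteq> 0" "l' \<noteq> 1" using assms(2,4) by auto
  have \<Delta>_l: "legendre_g2 l ^ 3 - 27 * legendre_g3 l ^ 2 \<noteq> 0"
    unfolding legendre_discriminant using l by (auto simp: power2_eq_square)
  have "j_of g2 g3 = modular_j \<tau>"
    by (simp add: j_of_def modular_j_def weierstrass_g2_def weierstrass_g3_def eisenstein_G_tau g2_def g3_def)
  hence "j_of g2 g3 = j_of (legendre_g2 l) (legendre_g3 l)"
    using assms(3) j_of_legendre[OF l] by simp
  then obtain \<mu> where \<mu>: "\<mu> \<noteq> 0" "g2 = \<mu> ^ 2 * legendre_g2 l" "g3 = \<mu> ^ 3 * legendre_g3 l"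
    using j_of_eq_imp_scale[OF _ \<Delta> \<Delta>_l] by blast
  obtain s where "s^2 = l * l'" "(l + l' + 6 * s)^2 = 16 * (1 + s)^2 * s" using assms(5) by blast
  then obtain p where p: "1 + 2 * p \<noteq> 0" "l = p * (2 + p) ^ 3 / (1 + 2 * p) ^ 3"
    "l' = p ^ 3 * (2 + p) / (1 + 2 * p)"
    using modular_equation_parametrization[OF l l'] by blast
  define c where "c = 9 / (1 + 2 * p) ^ 2"
  define x where "x = (p + 2)^2 / (3 * (1 + 2 * p)) - (l + 1) / 3"
  note iso = legendre_isogeny[OF p(1), folded p(2,3), folded c_def x_def]
  \<comment> \<open>The quartic is homogeneous of weight 4 when \<open>x\<close>, \<open>g2\<close>,
    \<open>g3\<close> have weights 1, 2, 3, so a root for the Legendre curve scales to a root for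
    the lattice.\<close>
  have "psi3 g2 g3 (\<mu> * x) = \<mu> ^ 4 * psi3 (legendre_g2 l) (legendre_g3 l) x"
    unfolding psi3_def \<mu>(2,3) by algebra
  hence "psi3 g2 g3 (\<mu> * x) = 0" using iso(1) by simp
  \<comment> \<open>The four torsion abscissas exhaust the roots of the quartic, so the algebraic
    root is the abscissa of an actual subgroup of order 3.\<close>
  hence root: "\<mu> * x \<in> set ?roots" using psi3_roots[OF distinct roots] by blast
  have "120 * (\<mu> * x) ^ 2 - 9 * g2 = (\<mu> * c) ^ 2 * legendre_g2 l'"
    using iso(2) unfolding \<mu>(2) by algebra
  moreover have "280 * (\<mu> * x) ^ 3 - 42 * g2 * (\<mu> * x) - 27 * g3 = (\<mu> * c) ^ 3 * legendre_g3 l'"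
    using iso(3) unfolding \<mu>(2,3) by algebra
  moreover have nz: "\<mu> * c \<noteq> 0" using \<mu>(1) p(1) by (simp add: c_def)
  ultimately have "J (\<mu> * x) = j_of (legendre_g2 l') (legendre_g3 l')"
    unfolding J_def by (simp only: j_of_scale[OF nz])
  hence "256 * ((l'^2 - l' + 1)^3 / (l'^2 - l')^2) = J (\<mu> * x)"
    using j_of_legendre[OF l'] by simp
  thus ?thesis unfolding J using root by auto
qed

end
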